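(* Let $I=(0,1)$, $d_I(t)=\min\{t,1-t\}$ for $t\in I$, let $-1<\beta<0$, and let $U_\beta(t)=d_I(t)^\beta$ for $t\in I$, extended by $0$ outside $I$. Let $H$ be the continuous function on $I\setminus\{1/2\}$ defined by \[ H(t)=-\frac{2}{t(1-t)}+\frac{2}{d_I(t)}\log\left(\frac{4t(1-t)}{(1-2t)^2}\right). \] Then \[ (-\Delta)^{\frac12}U_\beta\le\beta\,H(t)\,U_\beta(t)+\frac{2}{t(1-t)}\,U_\beta(t)\quad\text{in }I, \] in weak sense. The function $H$ has the following properties: - it is symmetric with respect to $1/2$, i.e. $H(t)=H(1-t)$ for $t\in I\setminus\{1/2\}$; - it belongs to $L^q_{\rm loc}(I)$ for every $1\le q<\infty$; - it satisfies $H(t)\sim-4\log\left(\left(\tfrac12-t\right)^2\right)$ for $t\to\tfrac12$ (the ratio of the two sides tends to $1$), thus the right-hand side of the differential inequality above diverges to $-\infty$ as $t$ approaches $1/2$. In particular, the function $U_\beta$ is not locally weakly $(1/2)$-superharmonic on $I$.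
   Context: The inequality $(-\Delta)^{1/2}U_\beta\le f$ in $I$ in weak sense means \[ \iint_{\mathbb{R}\times\mathbb{R}}\frac{(U_\beta(t)-U_\beta(y))(\varphi(t)-\varphi(y))}{|t-y|^2}\,dt\,dy\le\int_I f(t)\,\varphi(t)\,dt \] for every non-negative $\varphi\in C^\infty_0(I)$ (smooth with compact support in $I$, extended by $0$). $U_\beta$ is locally weakly $(1/2)$-superharmonic on $I$ if the left-hand side above is $\ge0$ for every non-negative $\varphi\in C^\infty_0(I)$. *)

theory Defs
  imports "HOL-Analysis.Analysis" "HOL-Library.Landau_Symbols"
begin

text \<open>Functions on an interval are total functions on the real line; members of
  \<open>test_fun I\<close> vanish outside \<open>I\<close>, which is the extension by zero.\<close>

definition test_fun :: "real set \<Rightarrow> (real \<Rightarrow> real) set" where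
  "test_fun I = {\<phi>. (\<forall>n. (deriv ^^ n) \<phi> differentiable_on UNIV) \<and>
     compact (closure {t. \<phi> t \<noteq> 0}) \<and> closure {t. \<phi> t \<noteq> 0} \<subseteq> I}"

text \<open>On the diagonal, a null set of the plane, the integrand is \<open>0 / 0 = 0\<close>.\<close>

definition gagliardo_integrand :: "(real \<Rightarrow> real) \<Rightarrow> (real \<Rightarrow> real) \<Rightarrow> real \<times> real \<Rightarrow> real" where
  "gagliardo_integrand u \<phi> = (\<lambda>(t, y). (u t - u y) * (\<phi> t - \<phi> y) / \<bar>t - y\<bar>\<^sup>2)"

definition gagliardo_form :: "(real \<Rightarrow> real) \<Rightarrow> (real \<Rightarrow> real) \<Rightarrow> real" where
  "gagliardo_form u \<phi> = (LINT z|lebesgue. gagliardo_integrand u \<phi> z)"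

text \<open>\<open>(-\<Delta>)\<^sup>1\<^sup>/\<^sup>2 u \<le> f\<close> in \<open>I\<close> in weak sense. The Bochner integral of a non-integrable function
  is \<open>0\<close>, so integrability of both sides is part of the definition.\<close>

definition half_laplacian_le_weakly ::
    "real set \<Rightarrow> (real \<Rightarrow> real) \<Rightarrow> (real \<Rightarrow> real) \<Rightarrow> bool" where
  "half_laplacian_le_weakly I u f \<longleftrightarrow>
     (\<forall>\<phi>\<in>test_fun I. (\<forall>t. 0 \<le> \<phi> t) \<longrightarrow>
        integrable lebesgue (gagliardo_integrand u \<phi>) \<and>
        set_integrable lebesgue I (\<lambda>t. f t * \<phi> t) \<and>
        gagliardo_form u \<phi> \<le> (LINT t:I|lebesgue. f t * \<phi> t))"

text \<open>Here integrability is not required, so the negation of this predicate provides a test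
  function whose form is negative, hence a genuine (integrable) value.\<close>

definition loc_weakly_half_superharmonic :: "real set \<Rightarrow> (real \<Rightarrow> real) \<Rightarrow> bool" where
  "loc_weakly_half_superharmonic I u \<longleftrightarrow>
     (\<forall>\<phi>\<in>test_fun I. (\<forall>t. 0 \<le> \<phi> t) \<longrightarrow> 0 \<le> gagliardo_form u \<phi>)"

definition Lq_loc :: "real \<Rightarrow> real set \<Rightarrow> (real \<Rightarrow> real) set" where
  "Lq_loc q I = {f. \<forall>K. compact K \<and> K \<subseteq> I \<longrightarrow>
     set_borel_measurable lebesgue K f \<and> set_integrable lebesgue K (\<lambda>t. \<bar>f t\<bar> powr q)}"

definition dI :: "real \<Rightarrow> real" where
  "dI t = min t (1 - t)"

definition U :: "real \<Rightarrow> real \<Rightarrow> real" where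
  "U \<beta> t = (if t \<in> {0<..<1} then dI t powr \<beta> else 0)"

text \<open>Only the values on \<open>(0,1) - {1/2}\<close> are meaningful.\<close>

definition H :: "real \<Rightarrow> real" where
  "H t = - 2 / (t * (1 - t)) + 2 / dI t * ln (4 * t * (1 - t) / (1 - 2 * t)\<^sup>2)"

end

theory Submission
  imports Defs "HOL-Real_Asymp.Real_Asymp"
begin

text \<open>
  The power \<open>x powr \<beta>\<close> is convex, hence its graph lies above its tangents. Applied to \<open>x = dI t\<close> this compares
  \<open>U \<beta> t - U \<beta> y\<close> with \<open>\<beta> * dI t powr (\<beta> - 1) * (dI t - dI y)\<close> for points of the interval. So the
  half-Laplacian of \<open>U \<beta>\<close> is controlled by that of \<open>dI\<close>, which is piecewise affine and can be computed: twice the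
  principal value of \<open>\<integral> (dI t - dI y) / (t - y)\<^sup>2 dy\<close> over the interval is \<open>dI t * H t\<close>. The points \<open>y\<close> outside the
  interval, where \<open>U \<beta>\<close> vanishes, contribute the potential \<open>2 / (t * (1 - t))\<close>.

  The proof avoids principal values of \<open>U \<beta>\<close> by using convexity in symmetric form. For a test function \<open>\<phi> \<ge> 0\<close> put
  \<open>w = - \<beta> * dI powr (\<beta> - 1) * \<phi>\<close>. The tangent inequalities at \<open>t\<close> and at \<open>y\<close> together bound the integrand
  \<open>(U \<beta> t - U \<beta> y) * (\<phi> t - \<phi> y)\<close> by \<open>- (dI t - dI y) * (w t - w y)\<close>; this is \<open>gagliardo_le_tent_form\<close>. The form of
  \<open>dI\<close> against the Lipschitz function \<open>w\<close> is evaluated exactly in \<open>tent_form_identity\<close>. Its core is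
  \<open>integral_difference_quotient_square\<close>, a statement about the finite Hilbert transform, obtained from a smoothed
  kernel by dominated convergence.

  The remaining assertions follow from the logarithmic singularity of \<open>H\<close> at \<open>1/2\<close>. It is integrable to every power,
  and it drives the right-hand side to \<open>-\<infinity>\<close>. Testing with a smooth bump concentrated at \<open>1/2\<close> then
  gives a negative value of the form, so \<open>U \<beta>\<close> is not superharmonic.
\<close>

section \<open>Integrals over intervals\<close>

lemma set_integrable_FTC_open:
  fixes F f :: "real \<Rightarrow> real"
  assumes "a \<le> b" and F: "\<And>x. x \<in> {a..b} \<Longrightarrow> (F has_real_derivative f x) (at x)"
    and f: "continuous_on {a..b} f"
  shows "set_integrable lborel {a<..<b} f"
    and "(LINT x:{a<..<b}|lborel. f x) = F b - F a"
proof -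
  have int: "set_integrable lborel {a..b} f"
    using f by (rule borel_integrable_atLeastAtMost')
  show "set_integrable lborel {a<..<b} f"
    by (rule set_integrable_subset[OF int]) auto
  have "(LINT x:{a<..<b}|lborel. f x) = (LINT x:{a..b}|lborel. f x)"
    by (rule set_integral_discrete_difference[where X = "{a, b}"]) auto
  also have "\<dots> = F b - F a"
    unfolding set_lebesgue_integral_def
    by (rule integral_FTC_atLeastAtMost)
       (use assms in \<open>auto intro: has_vector_derivative_at_within
          simp: has_real_derivative_iff_has_vector_derivative\<close>)
  finally show "(LINT x:{a<..<b}|lborel. f x) = F b - F a" .
qed

lemma set_integrable_affine:
  fixes f :: "real \<Rightarrow> real"
  assumes "c \<noteq> 0" "set_integrable lborel A f"
  shows "set_integrable lborel ((\<lambda>x. t + c * x) -` A) (\<lambda>x. f (t + c * x))"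
  using lborel_integrable_real_affine[of "\<lambda>x. indicator A x *\<^sub>R f x" c t] assms
  by (simp add: set_integrable_def indicator_def)

lemma set_integral_reflect:
  fixes f :: "real \<Rightarrow> real"
  shows "(LINT x:A|lborel. f x) = (LINT x:(\<lambda>x. c - x) -` A|lborel. f (c - x))"
  using lborel_integral_real_affine[of "-1" "\<lambda>x. indicator A x *\<^sub>R f x" c]
  by (simp add: set_lebesgue_integral_def indicator_def)

lemma set_integrable_reflect:
  fixes f :: "real \<Rightarrow> real"
  assumes "set_integrable lborel A f"
  shows "set_integrable lborel ((\<lambda>x. c - x) -` A) (\<lambda>x. f (c - x))"
  using set_integrable_affine[of "-1" A f c] assms by simp

lemma set_integrable_powr:
  assumes "-1 < r"
  shows "set_integrable lborel {0<..<c} (\<lambda>x::real. x powr r)"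
proof -
  have "(\<lambda>x. x powr r) absolutely_integrable_on {0..max c 0}"
    by (rule nonnegative_absolutely_integrable_1[OF integrable_on_powr_from_0[OF assms]]) auto
  then have "set_integrable lborel {0..max c 0} (\<lambda>x. x powr r)"
    unfolding set_integrable_def by (subst (asm) integrable_completion) auto
  then show ?thesis by (rule set_integrable_subset) auto
qed

text \<open>Near the origin the logarithm is dominated by every negative power. This makes all the
  logarithmic singularities below integrable, and also their powers of every order.\<close>

lemma abs_ln_le_powr:
  fixes x r :: real
  assumes "0 < x" "x \<le> 1" "0 < r"
  shows "\<bar>ln x\<bar> \<le> x powr (-r) / r"
  using ln_powr_bound[of "1/x" r] assms
  by (simp add: ln_div powr_divide powr_minus divide_simps)

lemma set_integrable_ln: "set_integrable lborel {0<..<c} (\<lambda>x::real. ln x)"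
proof (rule set_integrable_bound)
  have "set_integrable lborel {0<..<c} (\<lambda>x::real. 2 * x powr (-1/2))"
    by (intro set_integrable_mult_right set_integrable_powr) auto
  moreover have "set_integrable lborel {0<..<c} (\<lambda>x::real. x powr 1)"
    by (intro set_integrable_powr) auto
  ultimately show "set_integrable lborel {0<..<c} (\<lambda>x::real. 2 * x powr (-1/2) + x powr 1)"
    by (rule set_integral_add(1))
  show "set_borel_measurable lborel {0<..<c} (\<lambda>x::real. ln x)"
    unfolding set_borel_measurable_def by measurable
  have "\<bar>ln x\<bar> \<le> 2 * x powr (-1/2) + x powr 1" if "0 < x" for x :: real
  proof (cases "x \<le> 1")
    case True
    then show ?thesis using abs_ln_le_powr[of x "1/2"] that by simp
  next
    case False
    then have "\<bar>ln x\<bar> \<le> x" using less_imp_le[OF ln_less_self[OF that]] by simp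
    then show ?thesis using that by (simp add: add_increasing)
  qed
  then show "AE x in lborel. x \<in> {0<..<c} \<longrightarrow> norm (ln x) \<le> norm (2 * x powr (-1/2) + x powr 1)"
    by (intro AE_I2) force
qed

lemma set_integrable_ln_endpoints:
  fixes a b :: real
  shows "set_integrable lborel {a<..<b} (\<lambda>t. ln (t - a))"
    and "set_integrable lborel {a<..<b} (\<lambda>t. ln (b - t))"
proof -
  have "(\<lambda>x. -a + 1 * x) -` {0<..<b-a} = {a<..<b}" "(\<lambda>x. b + (-1) * x) -` {0<..<b-a} = {a<..<b}"
    by auto
  with set_integrable_affine[OF _ set_integrable_ln, of 1 "-a" "b - a"]
       set_integrable_affine[OF _ set_integrable_ln, of "-1" b "b - a"]
  show "set_integrable lborel {a<..<b} (\<lambda>t. ln (t - a))"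
       "set_integrable lborel {a<..<b} (\<lambda>t. ln (b - t))"
    by simp_all
qed

lemma set_integrable_mult_bounded:
  fixes f g :: "real \<Rightarrow> real"
  assumes f: "set_integrable lborel A f" and g: "g \<in> borel_measurable borel"
    and M: "\<And>x. x \<in> A \<Longrightarrow> \<bar>g x\<bar> \<le> M"
  shows "set_integrable lborel A (\<lambda>x. g x * f x)"
proof (rule set_integrable_bound)
  show "set_integrable lborel A (\<lambda>x. M * f x)" using f by simp
  have "(\<lambda>x. indicator A x *\<^sub>R f x) \<in> borel_measurable lborel"
    using f unfolding set_integrable_def by auto
  then have "(\<lambda>x. g x * (indicator A x *\<^sub>R f x)) \<in> borel_measurable lborel"
    using g by measurable
  then show "set_borel_measurable lborel A (\<lambda>x. g x * f x)"
    unfolding set_borel_measurable_def by (simp add: mult_ac)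
  show "AE x in lborel. x \<in> A \<longrightarrow> norm (g x * f x) \<le> norm (M * f x)"
  proof (intro AE_I2 impI)
    fix x assume "x \<in> A"
    then have "\<bar>g x\<bar> \<le> \<bar>M\<bar>" using M[of x] by linarith
    then show "norm (g x * f x) \<le> norm (M * f x)" by (simp add: abs_mult mult_right_mono)
  qed
qed

section \<open>Integrals over rectangles\<close>

lemma borel_measurable_planeI:
  fixes f :: "real \<times> real \<Rightarrow> real"
  shows "f \<in> borel_measurable (borel \<Otimes>\<^sub>M borel) \<Longrightarrow> f \<in> borel_measurable borel"
  by (simp add: borel_prod)

lemma set_integral_plane_Fubini:
  fixes f :: "real \<times> real \<Rightarrow> real"
  assumes "set_integrable lborel (A \<times> B) f"
  shows "(LINT z:A \<times> B|lborel. f z) = (LINT t:A|lborel. LINT y:B|lborel. f (t, y))"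
    and "set_integrable lborel A (\<lambda>t. LINT y:B|lborel. f (t, y))"
proof -
  have *: "integrable (lborel \<Otimes>\<^sub>M lborel) (\<lambda>z. indicator (A \<times> B) z *\<^sub>R f z)"
    using assms by (simp add: set_integrable_def lborel_prod)
  have eq: "(\<integral>y. indicator (A \<times> B) (t, y) *\<^sub>R f (t, y) \<partial>lborel) =
      indicator A t *\<^sub>R (LINT y:B|lborel. f (t, y))" for t
    by (simp add: set_lebesgue_integral_def indicator_times mult.assoc)
  show "(LINT z:A \<times> B|lborel. f z) = (LINT t:A|lborel. LINT y:B|lborel. f (t, y))"
    using lborel_pair.integral_fst'[OF *] unfolding eq
    by (simp add: set_lebesgue_integral_def lborel_prod)
  show "set_integrable lborel A (\<lambda>t. LINT y:B|lborel. f (t, y))"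
    using lborel_pair.integrable_fst'[OF *] unfolding eq by (simp add: set_integrable_def)
qed

lemma set_integrable_plane_Tonelli:
  fixes f :: "real \<times> real \<Rightarrow> real"
  assumes [measurable]: "A \<in> sets borel" "B \<in> sets borel" "f \<in> borel_measurable borel"
    and nonneg: "\<And>t y. t \<in> A \<Longrightarrow> y \<in> B \<Longrightarrow> 0 \<le> f (t, y)"
    and inner: "\<And>t. t \<in> A \<Longrightarrow> set_integrable lborel B (\<lambda>y. f (t, y))"
    and outer: "set_integrable lborel A (\<lambda>t. LINT y:B|lborel. f (t, y))"
  shows "set_integrable lborel (A \<times> B) f"
proof -
  let ?g = "\<lambda>z. indicator (A \<times> B) z *\<^sub>R f z"
  have "integrable (lborel \<Otimes>\<^sub>M lborel) ?g"
  proof (rule lborel_pair.Fubini_integrable)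
    have "?g \<in> borel_measurable borel"
      by (intro borel_measurable_scaleR borel_measurable_indicator) (auto intro: borel_Times)
    then show "?g \<in> borel_measurable (lborel \<Otimes>\<^sub>M lborel)"
      by (simp add: lborel_prod)
    have "norm (?g (t, y)) = indicator A t *\<^sub>R (indicator B y *\<^sub>R f (t, y))" for t y
      using nonneg by (auto simp: indicator_def)
    then show "integrable lborel (\<lambda>t. \<integral>y. norm (?g (t, y)) \<partial>lborel)"
      using outer by (simp add: set_integrable_def set_lebesgue_integral_def)
    show "AE t in lborel. integrable lborel (\<lambda>y. ?g (t, y))"
      using inner by (intro AE_I2) (auto simp: set_integrable_def indicator_times split: split_indicator)
  qed
  then show ?thesis by (simp add: set_integrable_def lborel_prod)
qed

lemma set_integral_plane_swap:
  fixes f :: "real \<times> real \<Rightarrow> real"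
  assumes "set_integrable lborel (A \<times> B) f"
  shows "set_integrable lborel (B \<times> A) (\<lambda>(y, t). f (t, y))"
    and "(LINT z:B \<times> A|lborel. (case z of (y, t) \<Rightarrow> f (t, y))) = (LINT z:A \<times> B|lborel. f z)"
proof -
  have *: "integrable (lborel \<Otimes>\<^sub>M lborel) (\<lambda>z. indicator (A \<times> B) z *\<^sub>R f z)"
    using assms by (simp add: set_integrable_def lborel_prod)
  have eq: "(\<lambda>(y, t). indicator (A \<times> B) (t, y) *\<^sub>R f (t, y)) =
      (\<lambda>z. indicator (B \<times> A) z *\<^sub>R (case z of (y, t) \<Rightarrow> f (t, y)))"
    by (auto simp: fun_eq_iff indicator_def)
  show "set_integrable lborel (B \<times> A) (\<lambda>(y, t). f (t, y))"
    using lborel_pair.integrable_product_swap[OF *] unfolding eq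
    by (simp add: set_integrable_def lborel_prod)
  show "(LINT z:B \<times> A|lborel. (case z of (y, t) \<Rightarrow> f (t, y))) = (LINT z:A \<times> B|lborel. f z)"
    using lborel_pair.integral_product_swap[OF borel_measurable_integrable[OF *]] unfolding eq
    by (simp add: set_lebesgue_integral_def lborel_prod)
qed

lemma set_integrable_plane_bounded:
  fixes f :: "real \<times> real \<Rightarrow> real"
  assumes [measurable]: "A \<in> sets borel" "B \<in> sets borel" "f \<in> borel_measurable borel"
    and fin: "emeasure lborel A < \<infinity>" "emeasure lborel B < \<infinity>"
    and M: "\<And>t y. t \<in> A \<Longrightarrow> y \<in> B \<Longrightarrow> \<bar>f (t, y)\<bar> \<le> M"
  shows "set_integrable lborel (A \<times> B) f"
proof (rule set_integrable_bound)
  have c: "set_integrable lborel X (\<lambda>_. c)" if "X \<in> sets borel" "emeasure lborel X < \<infinity>"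
    for X :: "real set" and c :: real
    using that by (simp add: set_integrable_def)
  have "set_integrable lborel (A \<times> B) (\<lambda>_. \<bar>M\<bar>)"
    by (rule set_integrable_plane_Tonelli)
       (use fin in \<open>auto intro!: c simp: set_lebesgue_integral_def\<close>)
  then show "set_integrable lborel (A \<times> B) (\<lambda>_. M)"
    by (simp add: set_integrable_def)
  show "set_borel_measurable lborel (A \<times> B) f"
    unfolding set_borel_measurable_def
    by (intro borel_measurable_scaleR borel_measurable_indicator) (auto intro: borel_Times)
  show "AE z in lborel. z \<in> A \<times> B \<longrightarrow> norm (f z) \<le> norm M"
    using M by (intro AE_I2) (force intro: order_trans)
qed

section \<open>Difference quotients of a Lipschitz function\<close>

text \<open>The kernel is \<open>1 / (t - y)\<close> with the singularity smoothed at scale \<open>e\<close>. Its primitive is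
  logarithmic and regular, so no principal value has to be taken.\<close>

lemma integral_odd_kernel:
  fixes a b t e :: real
  assumes "a \<le> b" "e \<noteq> 0"
  shows "(LINT y:{a<..<b}|lborel. (t - y) / ((t - y)\<^sup>2 + e\<^sup>2)) =
    (ln ((t - a)\<^sup>2 + e\<^sup>2) - ln ((t - b)\<^sup>2 + e\<^sup>2)) / 2"
proof -
  have pos: "(t - y)\<^sup>2 + e\<^sup>2 > 0" for y using assms by (simp add: sum_power2_gt_zero_iff)
  have nz: "(t - y)\<^sup>2 + e\<^sup>2 \<noteq> 0" for y using pos[of y] by (metis less_irrefl)
  have "((\<lambda>y. - ln ((t - y)\<^sup>2 + e\<^sup>2) / 2) has_real_derivative (t - y) / ((t - y)\<^sup>2 + e\<^sup>2)) (at y)" for y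
  proof -
    have "((\<lambda>y. ln ((t - y)\<^sup>2 + e\<^sup>2)) has_real_derivative
        1 / ((t - y)\<^sup>2 + e\<^sup>2) * (- 2 * (t - y))) (at y)"
      by (rule DERIV_chain2[where f = ln and g = "\<lambda>y. (t - y)\<^sup>2 + e\<^sup>2", OF DERIV_ln_divide[OF pos]])
         (auto intro!: derivative_eq_intros)
    from DERIV_cmult[OF this, of "- 1 / 2"]
    have "((\<lambda>y. - 1 / 2 * ln ((t - y)\<^sup>2 + e\<^sup>2)) has_real_derivative
        - 1 / 2 * (1 / ((t - y)\<^sup>2 + e\<^sup>2) * (- 2 * (t - y)))) (at y)" .
    moreover have "- 1 / 2 * (1 / ((t - y)\<^sup>2 + e\<^sup>2) * (- 2 * (t - y))) =
        (t - y) / ((t - y)\<^sup>2 + e\<^sup>2)"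
      by (simp only: times_divide_eq_left times_divide_eq_right)
    ultimately show ?thesis by simp
  qed
  moreover have "continuous_on {a..b} (\<lambda>y. (t - y) / ((t - y)\<^sup>2 + e\<^sup>2))"
    using nz by (intro continuous_intros) auto
  ultimately show ?thesis
    using set_integrable_FTC_open(2)[OF \<open>a \<le> b\<close>, of "\<lambda>y. - ln ((t - y)\<^sup>2 + e\<^sup>2) / 2"
        "\<lambda>y. (t - y) / ((t - y)\<^sup>2 + e\<^sup>2)"]
    by (simp add: diff_divide_distrib)
qed

text \<open>The bound is uniform in the smoothing scale \<open>e\<close>, which makes the passage to the limit \<open>e \<longrightarrow> 0\<close>
  dominated.\<close>

lemma ln_regularized_le:
  fixes x c e :: real
  assumes "0 < x" "x \<le> c" "\<bar>e\<bar> \<le> 1"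
  shows "\<bar>ln (x\<^sup>2 + e\<^sup>2)\<bar> \<le> 2 * \<bar>ln x\<bar> + ln (c\<^sup>2 + 1)"
proof -
  have "0 < c" using assms by simp
  have e: "e\<^sup>2 \<le> 1" using assms by (simp add: abs_square_le_1)
  have "2 * ln x \<le> ln (x\<^sup>2 + e\<^sup>2)"
    using assms by (subst ln_realpow[symmetric, where n = 2, simplified]) (auto simp: add_pos_nonneg)
  moreover have "ln (x\<^sup>2 + e\<^sup>2) \<le> ln (c\<^sup>2 + 1)"
    using assms e \<open>0 < c\<close> by (subst ln_le_cancel_iff) (auto intro!: add_mono power_mono add_pos_nonneg)
  moreover have "0 \<le> ln (c\<^sup>2 + 1)" by simp
  ultimately show ?thesis by linarith
qed

text \<open>Formally the integral splits into two equal parts, each being the integral of \<open>w\<close> against the principal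
  value of \<open>\<integral>\<^sub>S 1 / (t - y) dy\<close>, which is \<open>ln (t - a) - ln (b - t)\<close>. The parts are not integrable on
  their own. After replacing \<open>1 / (t - y)\<close> by \<open>(t - y) / ((t - y)\<^sup>2 + e\<^sup>2)\<close> they are: Fubini and the antisymmetry of
  the kernel give the identity at scale \<open>e\<close>. Both sides then converge as \<open>e\<close> tends to \<open>0\<close>, the left one
  dominated by the Lipschitz constant and the right one by logarithms.\<close>

proposition integral_difference_quotient_square:
  fixes w :: "real \<Rightarrow> real"
  assumes lip: "L-lipschitz_on UNIV w" and "a < b"
  defines "S \<equiv> {a<..<b}"
  shows "set_integrable lborel (S \<times> S) (\<lambda>(t, y). (w t - w y) / (t - y))"
    and "(LINT z:S \<times> S|lborel. (case z of (t, y) \<Rightarrow> (w t - w y) / (t - y))) =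
      2 * (LINT t:S|lborel. w t * (ln (t - a) - ln (b - t)))"
proof -
  let ?q = "\<lambda>(t, y). (w t - w y) / (t - y)"
  have w_cont: "continuous_on UNIV w" using lip by (rule lipschitz_on_continuous_on)
  then have [measurable]: "w \<in> borel_measurable borel" by (rule borel_measurable_continuous_onI)
  have L: "0 \<le> L" and wL: "\<bar>w t - w y\<bar> \<le> L * \<bar>t - y\<bar>" for t y
    using lip by (auto simp: lipschitz_on_def dist_real_def)
  define M where "M = \<bar>w a\<bar> + L * (b - a)"
  have wM: "\<bar>w t\<bar> \<le> M" if "t \<in> S" for t
  proof -
    have "L * \<bar>t - a\<bar> \<le> L * (b - a)" using that L by (intro mult_left_mono) (auto simp: S_def)
    then show ?thesis using wL[of t a] by (simp add: M_def)
  qed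
  have M: "0 \<le> M" using L \<open>a < b\<close> by (simp add: M_def)
  have S[measurable]: "S \<in> sets borel" and fin: "emeasure lborel S < \<infinity>"
    using \<open>a < b\<close> by (auto simp: S_def)
  have q_le: "\<bar>?q (t, y)\<bar> \<le> L" for t y
    using wL[of t y] L by (cases "t = y") (auto simp: abs_divide divide_le_eq)
  show q_int: "set_integrable lborel (S \<times> S) ?q"
  proof (rule set_integrable_plane_bounded[OF S S _ fin fin])
    show "?q \<in> borel_measurable borel" by (rule borel_measurable_planeI) measurable
  qed (rule q_le)
  define e where "e n = inverse (real (Suc n))" for n
  have e: "e n \<noteq> 0" "\<bar>e n\<bar> \<le> 1" "0 < e n" for n by (auto simp: e_def divide_simps)
  have e0: "e \<longlonglongrightarrow> 0" unfolding e_def by (rule LIMSEQ_inverse_real_of_nat)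
  define k where "k n = (\<lambda>(t, y). (t - y) / ((t - y)\<^sup>2 + (e n)\<^sup>2))" for n
  define A where "A n t = ln ((t - a)\<^sup>2 + (e n)\<^sup>2) - ln ((b - t)\<^sup>2 + (e n)\<^sup>2)" for n t
  have k_meas[measurable]: "k n \<in> borel_measurable (borel \<Otimes>\<^sub>M borel)" for n
    unfolding k_def by measurable
  have k_le: "\<bar>k n (t, y)\<bar> \<le> 1 / e n" for n t y
  proof -
    have "e n * \<bar>t - y\<bar> \<le> (t - y)\<^sup>2 + (e n)\<^sup>2"
    proof -
      have "0 \<le> (e n - \<bar>t - y\<bar>)\<^sup>2" "0 \<le> e n * \<bar>t - y\<bar>" using e(3)[of n] by auto
      then show ?thesis by (simp add: power2_diff)
    qed
    moreover have "0 < (t - y)\<^sup>2 + (e n)\<^sup>2" using e(1)[of n] by (simp add: sum_power2_gt_zero_iff)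
    ultimately show ?thesis using e(3)[of n] by (simp add: k_def abs_divide divide_simps mult_ac)
  qed
  have wk_int: "set_integrable lborel (S \<times> S) (\<lambda>(t, y). w t * k n (t, y))" for n
  proof (rule set_integrable_plane_bounded[OF S S _ fin fin])
    show "(\<lambda>(t, y). w t * k n (t, y)) \<in> borel_measurable borel"
      by (rule borel_measurable_planeI) measurable
    show "\<bar>case (t, y) of (t, y) \<Rightarrow> w t * k n (t, y)\<bar> \<le> M * (1 / e n)" if "t \<in> S" "y \<in> S" for t y
      unfolding prod.case abs_mult using wM[OF that(1)] k_le[of n t y] M by (intro mult_mono) auto
  qed
  have wk: "(LINT z:S \<times> S|lborel. (case z of (t, y) \<Rightarrow> w t * k n (t, y))) =
      (LINT t:S|lborel. w t * A n t / 2)" for n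
  proof -
    have "(LINT y:S|lborel. w t * k n (t, y)) = w t * A n t / 2" for t
      using integral_odd_kernel[of a b "e n" t] \<open>a < b\<close> e(1)[of n]
      by (simp add: k_def A_def S_def power2_commute[of b] del: times_divide_eq_right)
    then show ?thesis unfolding set_integral_plane_Fubini(1)[OF wk_int] prod.case by (simp only:)
  qed
  \<comment> \<open>Swapping the variables turns the term with \<open>w y\<close> into the one with \<open>w t\<close>, since the kernel is odd.\<close>
  have reg: "(LINT z:S \<times> S|lborel. (case z of (t, y) \<Rightarrow> (w t - w y) * k n (t, y))) =
      (LINT t:S|lborel. w t * A n t)" for n
  proof -
    have k_odd: "k n (y, t) = - k n (t, y)" for t y
      by (simp add: k_def power2_commute minus_divide_left)
    note sw = set_integral_plane_swap[OF wk_int[of n], unfolded prod.case]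
    have "(LINT z:S \<times> S|lborel. (case z of (t, y) \<Rightarrow> (w t - w y) * k n (t, y))) =
       (LINT z:S \<times> S|lborel. (case z of (t, y) \<Rightarrow> w t * k n (t, y)) + (case z of (y, t) \<Rightarrow> w t * k n (t, y)))"
    proof (rule set_lebesgue_integral_cong, simp add: borel_Times, intro allI impI)
      fix z :: "real \<times> real"
      obtain t y where z: "z = (t, y)" by (cases z)
      show "(case z of (t, y) \<Rightarrow> (w t - w y) * k n (t, y)) =
          (case z of (t, y) \<Rightarrow> w t * k n (t, y)) + (case z of (y, t) \<Rightarrow> w t * k n (t, y))"
        unfolding z prod.case k_odd[of t y] by (simp add: algebra_simps)
    qed
    also have "\<dots> = (LINT t:S|lborel. w t * A n t / 2) + (LINT t:S|lborel. w t * A n t / 2)"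
      using wk_int[of n] sw by (simp add: set_integral_add(2) wk)
    also have "\<dots> = (LINT t:S|lborel. w t * A n t)" by simp
    finally show ?thesis .
  qed
  have lim_l: "(\<lambda>n. LINT z:S \<times> S|lborel. (case z of (t, y) \<Rightarrow> (w t - w y) * k n (t, y)))
     \<longlonglongrightarrow> (LINT z:S \<times> S|lborel. ?q z)"
    unfolding set_lebesgue_integral_def
  proof (rule integral_dominated_convergence[where w = "\<lambda>z. indicator (S \<times> S) z *\<^sub>R L"])
    show "integrable lborel (\<lambda>z. indicator (S \<times> S) z *\<^sub>R L)"
      using set_integrable_plane_bounded[OF S S _ fin fin, of "\<lambda>_. L" L] L by (simp add: set_integrable_def)
    show "(\<lambda>z. indicator (S \<times> S) z *\<^sub>R ?q z) \<in> borel_measurable lborel"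
      using q_int unfolding set_integrable_def by (rule borel_measurable_integrable)
    have *: "(\<lambda>(t, y). (w t - w y) * k n (t, y)) \<in> borel_measurable borel" for n
      by (rule borel_measurable_planeI) measurable
    show "(\<lambda>z. indicator (S \<times> S) z *\<^sub>R (case z of (t, y) \<Rightarrow> (w t - w y) * k n (t, y)))
        \<in> borel_measurable lborel" for n
      using * by (intro borel_measurable_scaleR borel_measurable_indicator) (auto intro: borel_Times)
    have kq: "(w t - w y) * k n (t, y) = ?q (t, y) * ((t - y)\<^sup>2 / ((t - y)\<^sup>2 + (e n)\<^sup>2))" for n t y
      by (cases "t = y") (auto simp: k_def power2_eq_square)
    have fr: "\<bar>(t - y)\<^sup>2 / ((t - y)\<^sup>2 + (e n)\<^sup>2)\<bar> \<le> 1" for n t y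
      using e(1)[of n] by (simp add: abs_divide sum_power2_gt_zero_iff)
    have "\<bar>(w t - w y) * k n (t, y)\<bar> \<le> L * 1" for n t y
      unfolding kq abs_mult using q_le[of t y] fr[of t y n] L by (intro mult_mono) auto
    then show "AE z in lborel. norm (indicator (S \<times> S) z *\<^sub>R (case z of (t, y) \<Rightarrow> (w t - w y) * k n (t, y)))
        \<le> indicator (S \<times> S) z *\<^sub>R L" for n
      by (intro AE_I2) (auto simp: indicator_def)
    have "(\<lambda>n. (w t - w y) * k n (t, y)) \<longlonglongrightarrow> ?q (t, y)" for t y
    proof (cases "t = y")
      case False
      have "(\<lambda>n. ?q (t, y) * ((t - y)\<^sup>2 / ((t - y)\<^sup>2 + (e n)\<^sup>2))) \<longlonglongrightarrow> ?q (t, y) * ((t - y)\<^sup>2 / ((t - y)\<^sup>2 + 0\<^sup>2))"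
        using False by (intro tendsto_intros e0) auto
      then show ?thesis unfolding kq using False by simp
    qed (simp add: k_def)
    then show "AE z in lborel. (\<lambda>n. indicator (S \<times> S) z *\<^sub>R (case z of (t, y) \<Rightarrow> (w t - w y) * k n (t, y)))
        \<longlonglongrightarrow> indicator (S \<times> S) z *\<^sub>R ?q z"
      by (intro AE_I2 tendsto_scaleR tendsto_const) auto
  qed
  let ?c = "2 * ln ((b - a)\<^sup>2 + 1)"
  have lim_r: "(\<lambda>n. LINT t:S|lborel. w t * A n t)
     \<longlonglongrightarrow> (LINT t:S|lborel. 2 * (w t * (ln (t - a) - ln (b - t))))"
    unfolding set_lebesgue_integral_def
  proof (rule integral_dominated_convergence[where w = "\<lambda>t. indicator S t *\<^sub>R
      (M * (2 * \<bar>ln (t - a)\<bar> + 2 * \<bar>ln (b - t)\<bar> + ?c))"])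
    have i: "set_integrable lborel S (\<lambda>t. 2 * \<bar>ln (t - a)\<bar>)" "set_integrable lborel S (\<lambda>t. 2 * \<bar>ln (b - t)\<bar>)"
      unfolding S_def by (intro set_integrable_mult_right set_integrable_abs set_integrable_ln_endpoints)+
    have "set_integrable lborel S (\<lambda>_. ?c)" using S fin unfolding set_integrable_def by simp
    from set_integral_add(1)[OF set_integral_add(1)[OF i] this]
    have "set_integrable lborel S (\<lambda>t. M * (2 * \<bar>ln (t - a)\<bar> + 2 * \<bar>ln (b - t)\<bar> + ?c))"
      by (rule set_integrable_mult_right)
    then show "integrable lborel (\<lambda>t. indicator S t *\<^sub>R
        (M * (2 * \<bar>ln (t - a)\<bar> + 2 * \<bar>ln (b - t)\<bar> + ?c)))"
      by (simp only: set_integrable_def)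
    show "(\<lambda>t. indicator S t *\<^sub>R (2 * (w t * (ln (t - a) - ln (b - t))))) \<in> borel_measurable lborel"
      by measurable
    show "(\<lambda>t. indicator S t *\<^sub>R (w t * A n t)) \<in> borel_measurable lborel" for n
      unfolding A_def by measurable
    show "AE t in lborel. norm (indicator S t *\<^sub>R (w t * A n t)) \<le> indicator S t *\<^sub>R
        (M * (2 * \<bar>ln (t - a)\<bar> + 2 * \<bar>ln (b - t)\<bar> + ?c))" for n
    proof (intro AE_I2)
      fix t
      show "norm (indicator S t *\<^sub>R (w t * A n t)) \<le> indicator S t *\<^sub>R
        (M * (2 * \<bar>ln (t - a)\<bar> + 2 * \<bar>ln (b - t)\<bar> + ?c))"
      proof (cases "t \<in> S")
        case True
        then have "\<bar>A n t\<bar> \<le> 2 * \<bar>ln (t - a)\<bar> + 2 * \<bar>ln (b - t)\<bar> + ?c"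
          using ln_regularized_le[of "t - a" "b - a" "e n"] ln_regularized_le[of "b - t" "b - a" "e n"] e
          unfolding A_def S_def by force
        then show ?thesis using True wM[OF True] M by (auto simp: abs_mult intro!: mult_mono)
      qed simp
    qed
    have "(\<lambda>n. w t * A n t) \<longlonglongrightarrow> 2 * (w t * (ln (t - a) - ln (b - t)))" if "t \<in> S" for t
    proof -
      have "(\<lambda>n. w t * A n t) \<longlonglongrightarrow> w t * (ln ((t - a)\<^sup>2 + 0\<^sup>2) - ln ((b - t)\<^sup>2 + 0\<^sup>2))"
        unfolding A_def using that by (intro tendsto_intros e0) (auto simp: S_def)
      then show ?thesis using that by (simp add: S_def ln_realpow algebra_simps)
    qed
    then show "AE t in lborel. (\<lambda>n. indicator S t *\<^sub>R (w t * A n t))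
        \<longlonglongrightarrow> indicator S t *\<^sub>R (2 * (w t * (ln (t - a) - ln (b - t))))"
      by (intro AE_I2) (auto simp: indicator_def)
  qed
  show "(LINT z:S \<times> S|lborel. ?q z) = 2 * (LINT t:S|lborel. w t * (ln (t - a) - ln (b - t)))"
    using LIMSEQ_unique[OF lim_l lim_r[folded reg]] by simp
qed

section \<open>The form of the distance function\<close>

text \<open>On the unit interval \<open>dI\<close> has the shape of a tent, affine on either side of \<open>1/2\<close>. Multiplied by
  \<open>w t - w y\<close>, this kernel is the integrand of the form of \<open>dI\<close> against \<open>w\<close>.\<close>

definition tent_kernel :: "real \<times> real \<Rightarrow> real" where
  "tent_kernel = (\<lambda>(t, y). (dI t - dI y) / (t - y)\<^sup>2)"

lemma dI_measurable[measurable]: "dI \<in> borel_measurable borel"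
  unfolding dI_def[abs_def] by measurable

lemma dI_lipschitz: "\<bar>dI t - dI y\<bar> \<le> \<bar>t - y\<bar>"
  by (auto simp: dI_def min_def)

lemma tent_kernel_measurable[measurable]: "tent_kernel \<in> borel_measurable (borel \<Otimes>\<^sub>M borel)"
  unfolding tent_kernel_def by measurable

lemma abs_tent_kernel_le: "\<bar>tent_kernel (t, y)\<bar> \<le> 1 / \<bar>t - y\<bar>"
proof (cases "t = y")
  case False
  have abs_quot: "\<bar>x\<bar> / x\<^sup>2 = 1 / \<bar>x\<bar>" for x :: real
    by (cases "x < 0") (simp_all add: power2_eq_square)
  have "\<bar>dI t - dI y\<bar> / (t - y)\<^sup>2 \<le> \<bar>t - y\<bar> / (t - y)\<^sup>2"
    by (intro divide_right_mono dI_lipschitz) auto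
  then show ?thesis by (simp add: tent_kernel_def abs_quot)
qed (simp add: tent_kernel_def)

text \<open>The two halves of the interval touch in a single point, so the singularity of \<open>1 / \<bar>t - y\<bar>\<close> is met only at
  a corner of the rectangle and is integrable there. Hence on this rectangle no cancellation is needed.\<close>

lemma set_integrable_inverse_distance:
  shows "set_integrable lborel ({0<..<1/2} \<times> {1/2<..<1}) (\<lambda>(t, y). 1 / \<bar>t - y\<bar> :: real)"
proof (rule set_integrable_plane_Tonelli)
  show "(\<lambda>(t, y). 1 / \<bar>t - y\<bar> :: real) \<in> borel_measurable borel"
    by (rule borel_measurable_planeI) measurable
  have inner: "set_integrable lborel {1/2<..<1} (\<lambda>y. 1 / \<bar>t - y\<bar>)"
     "(LINT y:{1/2<..<1}|lborel. 1 / \<bar>t - y\<bar>) = ln (1 - t) - ln (1/2 - t)"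
    if t: "t \<in> {0<..<1/2}" for t :: real
  proof -
    have "((\<lambda>y. ln (y - t)) has_real_derivative 1 / \<bar>t - y\<bar>) (at y)" if "y \<in> {1/2..1}" for y
      using that t by (auto intro!: derivative_eq_intros)
    moreover have "continuous_on {1/2..1} (\<lambda>y. 1 / \<bar>t - y\<bar>)"
      using t by (intro continuous_intros) auto
    ultimately show "set_integrable lborel {1/2<..<1} (\<lambda>y. 1 / \<bar>t - y\<bar>)"
     "(LINT y:{1/2<..<1}|lborel. 1 / \<bar>t - y\<bar>) = ln (1 - t) - ln (1/2 - t)"
      using set_integrable_FTC_open[of "1/2" 1 "\<lambda>y. ln (y - t)" "\<lambda>y. 1 / \<bar>t - y\<bar>"] by simp_all
  qed
  show "set_integrable lborel {1/2<..<1} (\<lambda>y. case (t, y) of (t, y) \<Rightarrow> 1 / \<bar>t - y\<bar>)"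
    if "t \<in> {0<..<1/2}" for t :: real using inner(1)[OF that] by simp
  have "set_integrable lborel {0<..<1/2} (\<lambda>t::real. ln (1 - t))"
    by (rule set_integrable_subset[OF set_integrable_ln_endpoints(2)[of 0 1]]) auto
  then have "set_integrable lborel {0<..<1/2} (\<lambda>t::real. ln (1 - t) - ln (1/2 - t))"
    by (intro set_integral_diff(1) set_integrable_ln_endpoints(2))
  then show "set_integrable lborel {0<..<1/2}
      (\<lambda>t::real. LINT y:{1/2<..<1}|lborel. case (t, y) of (t, y) \<Rightarrow> 1 / \<bar>t - y\<bar>)"
    by (subst set_integrable_cong[OF refl refl]) (auto simp: inner(2))
qed auto

lemma set_integrable_mult_tent_kernel:
  fixes w :: "real \<Rightarrow> real"
  assumes [measurable]: "w \<in> borel_measurable borel" "X \<in> sets borel" "Y \<in> sets borel"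
    and int: "set_integrable lborel (X \<times> Y) (\<lambda>(t, y). 1 / \<bar>t - y\<bar>)"
    and M: "\<And>t. t \<in> X \<Longrightarrow> \<bar>w t\<bar> \<le> M" and "0 \<le> M"
  shows "set_integrable lborel (X \<times> Y) (\<lambda>(t, y). w t * tent_kernel (t, y))"
proof (rule set_integrable_bound)
  show "set_integrable lborel (X \<times> Y) (\<lambda>z. M * (case z of (t, y) \<Rightarrow> 1 / \<bar>t - y\<bar>))"
    using int by simp
  have "(\<lambda>(t, y). w t * tent_kernel (t, y)) \<in> borel_measurable borel"
    by (rule borel_measurable_planeI) measurable
  then show "set_borel_measurable lborel (X \<times> Y) (\<lambda>(t, y). w t * tent_kernel (t, y))"
    unfolding set_borel_measurable_def
    by (intro borel_measurable_scaleR borel_measurable_indicator) (auto intro: borel_Times)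
  have "\<bar>w t * tent_kernel (t, y)\<bar> \<le> \<bar>M * (1 / \<bar>t - y\<bar>)\<bar>" if "t \<in> X" for t y
    unfolding abs_mult using M[OF that] \<open>0 \<le> M\<close> abs_tent_kernel_le[of t y] by (intro mult_mono) auto
  then show "AE z in lborel. z \<in> X \<times> Y \<longrightarrow> norm (case z of (t, y) \<Rightarrow> w t * tent_kernel (t, y))
      \<le> norm (M * (case z of (t, y) \<Rightarrow> 1 / \<bar>t - y\<bar>))"
    unfolding real_norm_def by (intro AE_I2 impI) (metis (mono_tags, lifting) SigmaE case_prod_conv)
qed

text \<open>For \<open>t < 1/2 < y\<close> the numerator \<open>t - (1 - y)\<close> equals \<open>(y - t) - (1 - 2 * t)\<close>, so the kernel has an
  elementary primitive in \<open>y\<close>.\<close>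

lemma integral_tent_kernel_left:
  fixes t :: real
  assumes t: "t \<in> {0<..<1/2}"
  shows "(LINT y:{1/2<..<1}|lborel. tent_kernel (t, y)) = ln (1 - t) - ln (1/2 - t) - 1 / (1 - t)"
proof -
  let ?f = "\<lambda>y. 1 / (y - t) - (1 - 2 * t) / (y - t)\<^sup>2"
  have "((\<lambda>y. ln (y - t) + (1 - 2 * t) / (y - t)) has_real_derivative ?f y) (at y)"
    if "y \<in> {1/2..1}" for y
    using that t by (auto intro!: derivative_eq_intros simp: power2_eq_square minus_divide_left)
  moreover have "continuous_on {1/2..1} ?f"
    using t by (intro continuous_intros) auto
  ultimately have "(LINT y:{1/2<..<1}|lborel. ?f y) =
      ln (1 - t) + (1 - 2 * t) / (1 - t) - (ln (1/2 - t) + (1 - 2 * t) / (1/2 - t))"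
    using set_integrable_FTC_open(2)[of "1/2" 1 "\<lambda>y. ln (y - t) + (1 - 2 * t) / (y - t)" ?f] by simp
  also have "(1 - 2 * t) / (1/2 - t) = 2" using t by (simp add: field_simps)
  also have "(1 - 2 * t) / (1 - t) = 2 - 1 / (1 - t)" using t by (simp add: field_simps)
  also have "(LINT y:{1/2<..<1}|lborel. ?f y) = (LINT y:{1/2<..<1}|lborel. tent_kernel (t, y))"
  proof (rule set_lebesgue_integral_cong, simp, intro allI impI)
    fix y :: real assume y: "y \<in> {1/2<..<1}"
    have "1 / (y - t) = (y - t) / (y - t)\<^sup>2" using t y by (simp add: power2_eq_square)
    then have "?f y = ((y - t) - (1 - 2 * t)) / (y - t)\<^sup>2" by (simp only: diff_divide_distrib)
    then show "?f y = tent_kernel (t, y)"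
      using t y by (simp add: tent_kernel_def dI_def power2_commute[of t])
  qed
  finally show ?thesis by simp
qed

lemma tent_kernel_reflect: "tent_kernel (1 - t, 1 - y) = tent_kernel (t, y)"
  by (simp add: tent_kernel_def dI_def min.commute power2_commute)

lemma integral_tent_kernel_right:
  fixes t :: real
  assumes t: "t \<in> {1/2<..<1}"
  shows "(LINT y:{0<..<1/2}|lborel. tent_kernel (t, y)) = ln t - ln (t - 1/2) - 1 / t"
proof -
  have "(LINT y:{0<..<1/2}|lborel. tent_kernel (t, y)) =
      (LINT y:(\<lambda>y. 1 - y) -` {0<..<1/2}|lborel. tent_kernel (t, 1 - y))"
    by (rule set_integral_reflect)
  also have "(\<lambda>y::real. 1 - y) -` {0<..<1/2} = {1/2<..<1}" by auto
  also have "(LINT y:{1/2<..<1}|lborel. tent_kernel (t, 1 - y)) =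
      (LINT y:{1/2<..<1}|lborel. tent_kernel (1 - t, y))"
    using tent_kernel_reflect[of "1 - t"] by simp
  also have "\<dots> = ln t - ln (t - 1/2) - 1 / t"
    using integral_tent_kernel_left[of "1 - t"] t by simp
  finally show ?thesis .
qed

lemma AE_fst_snd_neq:
  fixes c :: real
  shows "AE z::real \<times> real in lborel. fst z \<noteq> c" "AE z::real \<times> real in lborel. snd z \<noteq> c"
proof -
  have e: "emeasure (lborel \<Otimes>\<^sub>M lborel) ({c} \<times> UNIV) = 0" "emeasure (lborel \<Otimes>\<^sub>M lborel) (UNIV \<times> {c}) = 0"
    by (simp_all add: lborel.emeasure_pair_measure_Times)
  have "{c} \<times> UNIV \<in> sets (borel :: (real \<times> real) measure)" "UNIV \<times> {c} \<in> sets (borel :: (real \<times> real) measure)"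
    by (intro borel_Times; simp)+
  with e have n: "{c} \<times> UNIV \<in> null_sets (lborel :: (real \<times> real) measure)"
      "UNIV \<times> {c} \<in> null_sets (lborel :: (real \<times> real) measure)"
    by (simp_all add: lborel_prod null_sets_def)
  show "AE z::real \<times> real in lborel. fst z \<noteq> c"
    using AE_not_in[OF n(1)] by eventually_elim (simp add: mem_Times_iff)
  show "AE z::real \<times> real in lborel. snd z \<noteq> c"
    using AE_not_in[OF n(2)] by eventually_elim (simp add: mem_Times_iff)
qed

lemma set_integral_cong_AE_set:
  fixes f :: "'a::euclidean_space \<Rightarrow> real"
  assumes [measurable]: "R \<in> sets borel" "Q \<in> sets borel" "f \<in> borel_measurable borel"
    and "AE z in lborel. z \<in> Q \<longleftrightarrow> z \<in> R" and "set_integrable lborel R f"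
  shows "set_integrable lborel Q f" "(LINT z:Q|lborel. f z) = (LINT z:R|lborel. f z)"
proof -
  have ae: "AE z in lborel. indicator R z *\<^sub>R f z = indicator Q z *\<^sub>R f z"
    using assms(4) by eventually_elim (simp add: indicator_def)
  have [measurable]: "(\<lambda>z. indicator R z *\<^sub>R f z) \<in> borel_measurable lborel"
      "(\<lambda>z. indicator Q z *\<^sub>R f z) \<in> borel_measurable lborel"
    by measurable
  show "set_integrable lborel Q f"
    using assms(5) unfolding set_integrable_def
    by (rule integrable_cong_AE_imp) (use ae in auto)
  show "(LINT z:Q|lborel. f z) = (LINT z:R|lborel. f z)"
    unfolding set_lebesgue_integral_def by (rule integral_cong_AE) (use ae in auto)
qed

lemma set_integrable_congI:
  fixes f g :: "'a \<Rightarrow> real"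
  assumes "\<And>z. z \<in> A \<Longrightarrow> f z = g z" and "set_integrable M A g"
  shows "set_integrable M A f"
proof -
  have "(\<lambda>z. indicator A z *\<^sub>R f z) = (\<lambda>z. indicator A z *\<^sub>R g z)"
    using assms(1) by (auto simp: indicator_def)
  then show ?thesis using assms(2) by (simp only: set_integrable_def)
qed

text \<open>The function \<open>H\<close> is, up to the factor \<open>dI\<close>, the weak half-Laplacian of \<open>dI\<close> relative to the interval.
  The square is cut at \<open>1/2\<close> into four rectangles. On the two squares along the diagonal \<open>dI\<close> is affine
  with slope \<open>1\<close> or \<open>-1\<close>, and the integrand is plus or minus a difference quotient of \<open>w\<close>. On the two
  other squares the terms with \<open>w t\<close> and with \<open>w y\<close> are separately integrable. The resulting
  logarithms add up to \<open>dI * H\<close>.\<close>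

proposition tent_form_identity:
  fixes w :: "real \<Rightarrow> real"
  assumes lip: "L-lipschitz_on UNIV w"
  shows "set_integrable lborel ({0<..<1} \<times> {0<..<1}) (\<lambda>(t, y). (w t - w y) * tent_kernel (t, y))"
    and "(LINT z:{0<..<1} \<times> {0<..<1}|lborel. (case z of (t, y) \<Rightarrow> (w t - w y) * tent_kernel (t, y))) =
      (LINT t:{0<..<1}|lborel. w t * (dI t * H t))"
    and "set_integrable lborel {0<..<1} (\<lambda>t. w t * (dI t * H t))"
proof -
  define J K :: "real set" where "J = {0<..<1/2}" and "K = {1/2<..<1}"
  have JK_sets[measurable]: "J \<in> sets borel" "K \<in> sets borel" by (auto simp: J_def K_def)
  let ?P = "\<lambda>(t, y). (w t - w y) * tent_kernel (t, y)"
  let ?lnJ = "\<lambda>t. ln t - ln (1/2 - t)" and ?lnK = "\<lambda>t. ln (t - 1/2) - ln (1 - t)"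
  let ?cJ = "\<lambda>t. ln (1 - t) - ln (1/2 - t) - 1 / (1 - t)" and ?cK = "\<lambda>t. ln t - ln (t - 1/2) - 1 / t"
  have w_cont: "continuous_on UNIV w" using lip by (rule lipschitz_on_continuous_on)
  then have w_meas[measurable]: "w \<in> borel_measurable borel" by (rule borel_measurable_continuous_onI)
  have "compact (w ` {0..1})"
    by (intro compact_continuous_image continuous_on_subset[OF w_cont]) auto
  then have "bounded (w ` {0..1})" by (rule compact_imp_bounded)
  then obtain M where M: "0 < M" "\<And>t. t \<in> {0..1} \<Longrightarrow> \<bar>w t\<bar> \<le> M"
    by (auto simp: bounded_pos)
  have P_meas: "?P \<in> borel_measurable borel"
    by (rule borel_measurable_planeI) measurable
  have quot: "x / x\<^sup>2 = 1 / x" for x :: real by (simp add: power2_eq_square)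
  have JJ_eq: "?P z = (case z of (t, y) \<Rightarrow> (w t - w y) / (t - y))" if z: "z \<in> J \<times> J" for z
  proof -
    obtain t y where ty: "z = (t, y)" by (cases z)
    have "tent_kernel (t, y) = (t - y) / (t - y)\<^sup>2"
      using z by (simp add: ty J_def tent_kernel_def dI_def)
    then show ?thesis by (simp add: ty quot)
  qed
  have KK_eq: "?P z = - (case z of (t, y) \<Rightarrow> (w t - w y) / (t - y))" if z: "z \<in> K \<times> K" for z
  proof -
    obtain t y where ty: "z = (t, y)" by (cases z)
    have "dI t - dI y = - (t - y)" using z by (simp add: ty K_def dI_def)
    then have "tent_kernel (t, y) = - ((t - y) / (t - y)\<^sup>2)"
      unfolding tent_kernel_def prod.case by (simp only: minus_divide_left)
    then show ?thesis by (simp add: ty quot)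
  qed
  note sqJ = integral_difference_quotient_square[OF lip, of 0 "1/2", folded J_def]
  note sqK = integral_difference_quotient_square[OF lip, of "1/2" 1, folded K_def]
  have JJ: "set_integrable lborel (J \<times> J) ?P" "(LINT z:J \<times> J|lborel. ?P z) = 2 * (LINT t:J|lborel. w t * ?lnJ t)"
  proof -
    show "set_integrable lborel (J \<times> J) ?P"
      by (rule set_integrable_congI[OF JJ_eq sqJ(1)]) simp_all
    have "(LINT z:J \<times> J|lborel. ?P z) = (LINT z:J \<times> J|lborel. (case z of (t, y) \<Rightarrow> (w t - w y) / (t - y)))"
      by (rule set_lebesgue_integral_cong) (use JJ_eq in \<open>auto simp: borel_Times\<close>)
    then show "(LINT z:J \<times> J|lborel. ?P z) = 2 * (LINT t:J|lborel. w t * ?lnJ t)"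
      using sqJ(2) by simp
  qed
  have KK: "set_integrable lborel (K \<times> K) ?P" "(LINT z:K \<times> K|lborel. ?P z) = - 2 * (LINT t:K|lborel. w t * ?lnK t)"
  proof -
    have "set_integrable lborel (K \<times> K) (\<lambda>z. - (case z of (t, y) \<Rightarrow> (w t - w y) / (t - y)))"
      using sqK(1) by (simp add: set_integrable_def)
    with KK_eq show "set_integrable lborel (K \<times> K) ?P" by (rule set_integrable_congI)
    have "(LINT z:K \<times> K|lborel. ?P z) = (LINT z:K \<times> K|lborel. - (case z of (t, y) \<Rightarrow> (w t - w y) / (t - y)))"
      by (rule set_lebesgue_integral_cong) (use KK_eq in \<open>auto simp: borel_Times\<close>)
    then show "(LINT z:K \<times> K|lborel. ?P z) = - 2 * (LINT t:K|lborel. w t * ?lnK t)"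
      using sqK by (simp add: set_integral_uminus)
  qed
  have iJK: "set_integrable lborel (J \<times> K) (\<lambda>(t, y). 1 / \<bar>t - y\<bar>)"
    using set_integrable_inverse_distance by (simp add: J_def K_def)
  have iKJ: "set_integrable lborel (K \<times> J) (\<lambda>(t, y). 1 / \<bar>t - y\<bar>)"
    using set_integral_plane_swap(1)[OF iJK] by (simp add: abs_minus_commute)
  have wJK: "set_integrable lborel (J \<times> K) (\<lambda>(t, y). w t * tent_kernel (t, y))"
    by (rule set_integrable_mult_tent_kernel[OF _ _ _ iJK, of _ M]) (use M in \<open>auto simp: J_def K_def\<close>)
  have wKJ: "set_integrable lborel (K \<times> J) (\<lambda>(t, y). w t * tent_kernel (t, y))"
    by (rule set_integrable_mult_tent_kernel[OF _ _ _ iKJ, of _ M]) (use M in \<open>auto simp: J_def K_def\<close>)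
  have cJ: "set_integrable lborel J (\<lambda>t. w t * ?cJ t)"
      "(LINT z:J \<times> K|lborel. (case z of (t, y) \<Rightarrow> w t * tent_kernel (t, y))) = (LINT t:J|lborel. w t * ?cJ t)"
  proof -
    have eq: "(LINT y:K|lborel. w t * tent_kernel (t, y)) = w t * ?cJ t" if "t \<in> J" for t
      using integral_tent_kernel_left[of t] that by (simp add: J_def K_def)
    show "set_integrable lborel J (\<lambda>t. w t * ?cJ t)"
      using set_integrable_congI[OF eq[symmetric] set_integral_plane_Fubini(2)[OF wJK, unfolded prod.case]] .
    show "(LINT z:J \<times> K|lborel. (case z of (t, y) \<Rightarrow> w t * tent_kernel (t, y))) = (LINT t:J|lborel. w t * ?cJ t)"
      unfolding set_integral_plane_Fubini(1)[OF wJK]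
      by (rule set_lebesgue_integral_cong) (use eq in auto)
  qed
  have cK: "set_integrable lborel K (\<lambda>t. w t * ?cK t)"
      "(LINT z:K \<times> J|lborel. (case z of (t, y) \<Rightarrow> w t * tent_kernel (t, y))) = (LINT t:K|lborel. w t * ?cK t)"
  proof -
    have eq: "(LINT y:J|lborel. w t * tent_kernel (t, y)) = w t * ?cK t" if "t \<in> K" for t
      using integral_tent_kernel_right[of t] that by (simp add: J_def K_def)
    show "set_integrable lborel K (\<lambda>t. w t * ?cK t)"
      using set_integrable_congI[OF eq[symmetric] set_integral_plane_Fubini(2)[OF wKJ, unfolded prod.case]] .
    show "(LINT z:K \<times> J|lborel. (case z of (t, y) \<Rightarrow> w t * tent_kernel (t, y))) = (LINT t:K|lborel. w t * ?cK t)"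
      unfolding set_integral_plane_Fubini(1)[OF wKJ]
      by (rule set_lebesgue_integral_cong) (use eq in auto)
  qed
  have odd: "tent_kernel (y, t) = - tent_kernel (t, y)" for t y
    by (simp add: tent_kernel_def power2_commute minus_divide_left)
  have P_split: "?P = (\<lambda>z. (case z of (t, y) \<Rightarrow> w t * tent_kernel (t, y)) + (case z of (y, t) \<Rightarrow> w t * tent_kernel (t, y)))"
  proof
    fix z :: "real \<times> real"
    obtain t y where z: "z = (t, y)" by (cases z)
    show "?P z = (case z of (t, y) \<Rightarrow> w t * tent_kernel (t, y)) + (case z of (y, t) \<Rightarrow> w t * tent_kernel (t, y))"
      unfolding z prod.case odd[of t y] by (simp add: algebra_simps)
  qed
  note swJK = set_integral_plane_swap[OF wJK, unfolded prod.case]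
  note swKJ = set_integral_plane_swap[OF wKJ, unfolded prod.case]
  have JK: "set_integrable lborel (J \<times> K) ?P"
      "(LINT z:J \<times> K|lborel. ?P z) = (LINT t:J|lborel. w t * ?cJ t) + (LINT t:K|lborel. w t * ?cK t)"
    unfolding P_split using set_integral_add[OF wJK swKJ(1)] swKJ(2) cJ cK by simp_all
  have KJ: "set_integrable lborel (K \<times> J) ?P"
      "(LINT z:K \<times> J|lborel. ?P z) = (LINT t:J|lborel. w t * ?cJ t) + (LINT t:K|lborel. w t * ?cK t)"
    unfolding P_split using set_integral_add[OF wKJ swJK(1)] swJK(2) cJ cK by simp_all
  define R where "R = (J \<times> J \<union> J \<times> K) \<union> (K \<times> J \<union> K \<times> K)"
  have disj: "(J \<times> J) \<inter> (J \<times> K) = {}" "(K \<times> J) \<inter> (K \<times> K) = {}"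
      "(J \<times> J \<union> J \<times> K) \<inter> (K \<times> J \<union> K \<times> K) = {}" by (auto simp: J_def K_def)
  have [measurable]: "R \<in> sets borel" unfolding R_def by (intro sets.Un borel_Times JK_sets)
  have U1: "set_integrable lborel (J \<times> J \<union> J \<times> K) ?P" "set_integrable lborel (K \<times> J \<union> K \<times> K) ?P"
    by (rule set_integrable_Un; use JJ JK KJ KK in \<open>simp add: borel_Times\<close>)+
  have R_int: "set_integrable lborel R ?P"
    unfolding R_def by (rule set_integrable_Un[OF U1]) (simp_all add: sets.Un borel_Times)
  have R_eq: "(LINT z:R|lborel. ?P z) =
      2 * (LINT t:J|lborel. w t * ?lnJ t) + 2 * (LINT t:J|lborel. w t * ?cJ t)
      + (- 2 * (LINT t:K|lborel. w t * ?lnK t) + 2 * (LINT t:K|lborel. w t * ?cK t))"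
    unfolding R_def using set_integral_Un[OF disj(3) U1]
      set_integral_Un[OF disj(1) JJ(1) JK(1)] set_integral_Un[OF disj(2) KJ(1) KK(1)] JJ JK KJ KK by simp
  \<comment> \<open>The four open rectangles miss only the lines where a coordinate is \<open>1/2\<close>.\<close>
  have ae: "AE z in lborel. z \<in> {0<..<1} \<times> {0<..<1} \<longleftrightarrow> z \<in> R"
    using AE_fst_snd_neq[of "1/2"] by eventually_elim (auto simp: R_def J_def K_def)
  have sq: "{0<..<1} \<times> {0<..<1} \<in> sets (borel :: (real \<times> real) measure)"
    by (auto intro!: borel_Times)
  show "set_integrable lborel ({0<..<1} \<times> {0<..<1}) ?P"
    by (rule set_integral_cong_AE_set(1)[OF _ sq P_meas ae R_int]) measurable
  have lnJ: "set_integrable lborel J (\<lambda>t. w t * ?lnJ t)"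
    using set_integrable_ln_endpoints[of 0 "1/2"] M
    by (intro set_integrable_mult_bounded[where M = M]) (auto simp: J_def intro: set_integral_diff(1))
  have lnK: "set_integrable lborel K (\<lambda>t. w t * ?lnK t)"
    using set_integrable_ln_endpoints[of "1/2" 1] M
    by (intro set_integrable_mult_bounded[where M = M]) (auto simp: K_def intro: set_integral_diff(1))
  have dH_J: "w t * (dI t * H t) = 2 * (w t * ?lnJ t) + 2 * (w t * ?cJ t)" if "t \<in> J" for t
  proof -
    have "4 * t * (1 - t) / (1 - 2 * t)\<^sup>2 = t * (1 - t) / (1/2 - t)\<^sup>2"
      using that by (simp add: J_def divide_simps power2_eq_square) (simp add: algebra_simps)
    then have "ln (4 * t * (1 - t) / (1 - 2 * t)\<^sup>2) = ln t + ln (1 - t) - 2 * ln (1/2 - t)"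
      using that by (simp add: J_def ln_div ln_mult ln_realpow)
    moreover have "t * (- 2 / (t * (1 - t)) + 2 / t * l) = - 2 / (1 - t) + 2 * l" for l
      using that by (simp add: J_def field_simps)
    moreover have "dI t = t" using that by (simp add: J_def dI_def)
    ultimately have "dI t * H t = - 2 / (1 - t) + 2 * (ln t + ln (1 - t) - 2 * ln (1/2 - t))"
      by (simp only: H_def)
    moreover have "x * (- 2 / c + 2 * (p + r - 2 * d)) = 2 * (x * (p - d)) + 2 * (x * (r - d - 1 / c))"
      for x c d p r :: real by (simp only: divide_inverse) (simp add: algebra_simps)
    ultimately show ?thesis by (simp only:)
  qed
  have dH_K: "w t * (dI t * H t) = - 2 * (w t * ?lnK t) + 2 * (w t * ?cK t)" if "t \<in> K" for t
  proof -
    have "4 * t * (1 - t) / (1 - 2 * t)\<^sup>2 = t * (1 - t) / (t - 1/2)\<^sup>2"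
      using that by (simp add: K_def divide_simps power2_eq_square) (simp add: algebra_simps)
    then have "ln (4 * t * (1 - t) / (1 - 2 * t)\<^sup>2) = ln t + ln (1 - t) - 2 * ln (t - 1/2)"
      using that by (simp add: K_def ln_div ln_mult ln_realpow)
    moreover have "s * (- 2 / (t * s) + 2 / s * l) = - 2 / t + 2 * l" if "s \<noteq> 0" for s l :: real
      using that \<open>t \<in> K\<close> by (simp add: K_def field_simps)
    from this[of "1 - t"]
    have "(1 - t) * (- 2 / (t * (1 - t)) + 2 / (1 - t) * l) = - 2 / t + 2 * l" for l
      using that by (simp add: K_def)
    moreover have "dI t = 1 - t" using that by (simp add: K_def dI_def)
    ultimately have "dI t * H t = - 2 / t + 2 * (ln t + ln (1 - t) - 2 * ln (t - 1/2))"
      by (simp only: H_def)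
    moreover have "x * (- 2 / c + 2 * (p + r - 2 * d)) = - 2 * (x * (d - r)) + 2 * (x * (p - d - 1 / c))"
      for x c d p r :: real by (simp only: divide_inverse) (simp add: algebra_simps)
    ultimately show ?thesis by (simp only:)
  qed
  have IJ: "set_integrable lborel J (\<lambda>t. w t * (dI t * H t))"
    "(LINT t:J|lborel. w t * (dI t * H t)) = 2 * (LINT t:J|lborel. w t * ?lnJ t) + 2 * (LINT t:J|lborel. w t * ?cJ t)"
  proof -
    have a: "set_integrable lborel J (\<lambda>t. 2 * (w t * ?lnJ t))" "set_integrable lborel J (\<lambda>t. 2 * (w t * ?cJ t))"
      by (intro set_integrable_mult_right lnJ cJ(1))+
    show "set_integrable lborel J (\<lambda>t. w t * (dI t * H t))"
      by (rule set_integrable_congI[OF dH_J set_integral_add(1)[OF a]])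
    have "(LINT t:J|lborel. w t * (dI t * H t)) = (LINT t:J|lborel. 2 * (w t * ?lnJ t) + 2 * (w t * ?cJ t))"
      by (rule set_lebesgue_integral_cong) (use dH_J in auto)
    then show "(LINT t:J|lborel. w t * (dI t * H t)) = 2 * (LINT t:J|lborel. w t * ?lnJ t) + 2 * (LINT t:J|lborel. w t * ?cJ t)"
      unfolding set_integral_add(2)[OF a] set_integral_mult_right .
  qed
  have IK: "set_integrable lborel K (\<lambda>t. w t * (dI t * H t))"
    "(LINT t:K|lborel. w t * (dI t * H t)) = - 2 * (LINT t:K|lborel. w t * ?lnK t) + 2 * (LINT t:K|lborel. w t * ?cK t)"
  proof -
    have a: "set_integrable lborel K (\<lambda>t. - 2 * (w t * ?lnK t))" "set_integrable lborel K (\<lambda>t. 2 * (w t * ?cK t))"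
      by (intro set_integrable_mult_right lnK cK(1))+
    show "set_integrable lborel K (\<lambda>t. w t * (dI t * H t))"
      by (rule set_integrable_congI[OF dH_K set_integral_add(1)[OF a]])
    have "(LINT t:K|lborel. w t * (dI t * H t)) = (LINT t:K|lborel. - 2 * (w t * ?lnK t) + 2 * (w t * ?cK t))"
      by (rule set_lebesgue_integral_cong) (use dH_K in auto)
    then show "(LINT t:K|lborel. w t * (dI t * H t)) = - 2 * (LINT t:K|lborel. w t * ?lnK t) + 2 * (LINT t:K|lborel. w t * ?cK t)"
      unfolding set_integral_add(2)[OF a] set_integral_mult_right .
  qed
  have "set_integrable lborel (J \<union> K) (\<lambda>t. w t * (dI t * H t))"
    by (rule set_integrable_Un[OF IJ(1) IK(1)]) simp_all
  then show "set_integrable lborel {0<..<1} (\<lambda>t. w t * (dI t * H t))"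
    by (rule set_integrable_discrete_difference[where X = "{1/2}", THEN iffD1, rotated -1])
       (auto simp: J_def K_def)
  have "(LINT t:{0<..<1}|lborel. w t * (dI t * H t)) = (LINT t:J \<union> K|lborel. w t * (dI t * H t))"
    by (rule set_integral_discrete_difference[where X = "{1/2}"]) (auto simp: J_def K_def)
  also have "\<dots> = (LINT t:J|lborel. w t * (dI t * H t)) + (LINT t:K|lborel. w t * (dI t * H t))"
    by (rule set_integral_Un[OF _ IJ(1) IK(1)]) (auto simp: J_def K_def)
  finally show "(LINT z:{0<..<1} \<times> {0<..<1}|lborel. ?P z) = (LINT t:{0<..<1}|lborel. w t * (dI t * H t))"
    using set_integral_cong_AE_set(2)[OF _ sq P_meas ae R_int] R_eq IJ(2) IK(2) by simp
qed

section \<open>Bump functions\<close>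

text \<open>The functions \<open>exp (- 1 / s) / s ^ k\<close>, extended by zero to \<open>s \<le> 0\<close>. They are the building blocks of all the derivatives
  of the classical flat function \<open>exp (- 1 / s)\<close>.\<close>

definition flat_quotient :: "nat \<Rightarrow> real \<Rightarrow> real" where
  "flat_quotient k s = (if 0 < s then (1 / s) ^ k * exp (- (1 / s)) else 0)"

text \<open>Quadratic decay at \<open>0\<close>, because \<open>exp u\<close> dominates \<open>u ^ n\<close>: the inequality \<open>(1 + u / n) ^ n \<le> exp u\<close> is
  used for \<open>u = 1 / s\<close>. It yields the vanishing derivative at the origin.\<close>

lemma flat_quotient_le:
  assumes "0 < s"
  shows "flat_quotient k s \<le> real (k + 2) ^ (k + 2) * s\<^sup>2"
proof -
  define n u where "n = k + 2" and "u = 1 / s"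
  have n: "0 < n" and u: "0 < u" using assms by (auto simp: n_def u_def)
  have "u ^ n = real n ^ n * (u / real n) ^ n"
    using n by (simp add: power_divide)
  also have "\<dots> \<le> real n ^ n * exp u"
  proof (rule mult_left_mono)
    have "(u / real n) ^ n \<le> (1 + u / real n) ^ n"
      using n u by (intro power_mono) auto
    also have "\<dots> \<le> exp u"
      using n u by (intro exp_ge_one_plus_x_over_n_power_n) auto
    finally show "(u / real n) ^ n \<le> exp u" .
  qed simp
  finally have "u ^ n * exp (- u) \<le> real n ^ n"
    by (simp add: exp_minus divide_simps)
  then have "s\<^sup>2 * (u ^ n * exp (- u)) \<le> s\<^sup>2 * real n ^ n"
    by (rule mult_left_mono) simp
  moreover have "s\<^sup>2 * (u ^ n * exp (- u)) = flat_quotient k s"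
    using assms by (simp add: flat_quotient_def n_def u_def power2_eq_square)
  ultimately show ?thesis by (simp only: n_def mult.commute)
qed

lemma flat_quotient_shift: "s * flat_quotient (Suc k) s = flat_quotient k s"
  by (simp add: flat_quotient_def)

lemma DERIV_flat_quotient:
  "(flat_quotient k has_real_derivative
     flat_quotient (k + 2) s - real k * flat_quotient (k + 1) s) (at s)"
proof -
  consider "0 < s" | "s < 0" | "s = 0" by linarith
  then show ?thesis
  proof cases
    case 1
    have inv: "((\<lambda>x. 1 / x) has_real_derivative - ((1 / s)\<^sup>2)) (at s)"
      using 1 by (auto intro!: derivative_eq_intros simp: power2_eq_square)
    have "((\<lambda>x. (1 / x) ^ k * exp (- (1 / x))) has_real_derivative
        flat_quotient (k + 2) s - real k * flat_quotient (k + 1) s) (at s)"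
      by (rule DERIV_mult[OF DERIV_power[OF inv] DERIV_chain2[OF DERIV_exp DERIV_minus[OF inv]],
            THEN DERIV_cong])
         (use 1 in \<open>cases k; simp add: flat_quotient_def power2_eq_square algebra_simps\<close>)
    moreover have "\<forall>\<^sub>F x in nhds s. x \<in> {0<..}"
      using 1 by (intro eventually_nhds_in_open) auto
    then have "\<forall>\<^sub>F x in nhds s. flat_quotient k x = (1 / x) ^ k * exp (- (1 / x))"
      by eventually_elim (simp add: flat_quotient_def)
    ultimately show ?thesis by (subst DERIV_cong_ev[OF refl _ refl]) auto
  next
    case 2
    have "\<forall>\<^sub>F x in nhds s. x \<in> {..<0}"
      using 2 by (intro eventually_nhds_in_open) auto
    then have "\<forall>\<^sub>F x in nhds s. flat_quotient k x = 0"
      by eventually_elim (simp add: flat_quotient_def)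
    then show ?thesis
      using 2 by (subst DERIV_cong_ev[OF refl _ refl]) (auto simp: flat_quotient_def)
  next
    case 3
    have "((\<lambda>h. flat_quotient k h / h) \<longlongrightarrow> 0) (at 0)"
    proof (rule Lim_null_comparison)
      show "\<forall>\<^sub>F h in at 0. norm (flat_quotient k h / h) \<le> real (k + 2) ^ (k + 2) * \<bar>h\<bar>"
      proof (intro always_eventually allI)
        fix h :: real
        have "0 \<le> real (k + 2) ^ (k + 2) * \<bar>h\<bar>" by (intro mult_nonneg_nonneg zero_le_power) auto
        show "norm (flat_quotient k h / h) \<le> real (k + 2) ^ (k + 2) * \<bar>h\<bar>"
        proof (cases "0 < h")
          case False
          then have "flat_quotient k h / h = 0" by (simp add: flat_quotient_def)
          then show ?thesis using \<open>0 \<le> real (k + 2) ^ (k + 2) * \<bar>h\<bar>\<close> by (simp only: norm_zero)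
        next
          case True
          have "0 \<le> flat_quotient k h" by (simp add: flat_quotient_def)
          then show ?thesis using flat_quotient_le[OF True, of k] True
            by (simp add: power2_eq_square divide_le_eq mult_ac del: of_nat_add power_add power_Suc)
        qed
      qed
      show "((\<lambda>h. real (k + 2) ^ (k + 2) * \<bar>h\<bar>) \<longlongrightarrow> 0) (at (0::real))"
        by (auto intro!: tendsto_eq_intros)
    qed
    then show ?thesis using 3 by (simp add: DERIV_def flat_quotient_def)
  qed
qed

text \<open>The products \<open>p * (flat_quotient k \<circ> q)\<close> with polynomials \<open>p\<close> and \<open>q\<close> form a class closed under
  differentiation for fixed \<open>q\<close>: the two new terms are brought to the common index \<open>k + 2\<close>.\<close>

lemma DERIV_poly_flat_quotient:
  fixes p q :: "real poly"
  shows "((\<lambda>x. poly p x * flat_quotient k (poly q x)) has_real_derivative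
     poly (pderiv p * q\<^sup>2 + p * pderiv q * (1 - of_nat k * q)) x * flat_quotient (k + 2) (poly q x)) (at x)"
proof -
  have "((\<lambda>x. poly p x * flat_quotient k (poly q x)) has_real_derivative
      poly (pderiv p) x * flat_quotient k (poly q x) +
      (flat_quotient (k + 2) (poly q x) - real k * flat_quotient (k + 1) (poly q x)) * poly (pderiv q) x * poly p x) (at x)"
    by (rule DERIV_mult[OF poly_DERIV DERIV_chain2[OF DERIV_flat_quotient poly_DERIV], THEN DERIV_cong]) simp
  moreover have "flat_quotient k (poly q x) = (poly q x)\<^sup>2 * flat_quotient (k + 2) (poly q x)"
    "flat_quotient (k + 1) (poly q x) = poly q x * flat_quotient (k + 2) (poly q x)"
    using flat_quotient_shift[of "poly q x" k] flat_quotient_shift[of "poly q x" "k + 1"]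
    by (simp_all add: power2_eq_square mult.assoc)
  ultimately show ?thesis
    by (elim DERIV_cong) (simp add: algebra_simps)
qed

lemma iterated_deriv_poly_flat_quotient:
  fixes q :: "real poly"
  shows "\<exists>p k. (deriv ^^ n) (\<lambda>x. flat_quotient 0 (poly q x)) = (\<lambda>x. poly p x * flat_quotient k (poly q x))"
proof (induction n)
  case 0
  show ?case by (intro exI[of _ 1] exI[of _ 0]) simp
next
  case (Suc n)
  then obtain p k where
    "(deriv ^^ n) (\<lambda>x. flat_quotient 0 (poly q x)) = (\<lambda>x. poly p x * flat_quotient k (poly q x))" by blast
  then have "(deriv ^^ Suc n) (\<lambda>x. flat_quotient 0 (poly q x)) =
      (\<lambda>x. poly (pderiv p * q\<^sup>2 + p * pderiv q * (1 - of_nat k * q)) x * flat_quotient (k + 2) (poly q x))"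
    using DERIV_imp_deriv[OF DERIV_poly_flat_quotient] by auto
  then show ?case by blast
qed

text \<open>The bump is \<open>exp (- 1 / q)\<close> on the interval where the quadratic \<open>q t = r\<^sup>2 - (t - c)\<^sup>2\<close> is positive.\<close>

lemma exists_bump_test_fun:
  fixes c r :: real
  assumes "0 < r" "{c - r..c + r} \<subseteq> I"
  obtains \<phi> where "\<phi> \<in> test_fun I" "\<And>t. 0 \<le> \<phi> t" "\<And>t. 0 < \<phi> t \<longleftrightarrow> t \<in> {c - r<..<c + r}"
proof
  define q where "q = [:r\<^sup>2 - c\<^sup>2, 2 * c, -1:]"
  have q: "poly q t = r\<^sup>2 - (t - c)\<^sup>2" for t
    by (simp add: q_def power2_eq_square algebra_simps)
  define \<phi> where "\<phi> = (\<lambda>t. flat_quotient 0 (poly q t))"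
  show nonneg: "0 \<le> \<phi> t" for t by (simp add: \<phi>_def flat_quotient_def)
  have "0 < poly q t \<longleftrightarrow> t \<in> {c - r<..<c + r}" for t
  proof -
    have "0 < poly q t \<longleftrightarrow> \<bar>t - c\<bar> < \<bar>r\<bar>" unfolding q using abs_le_square_iff[of r "t - c"] by auto
    then show ?thesis using \<open>0 < r\<close> by auto
  qed
  then show pos: "0 < \<phi> t \<longleftrightarrow> t \<in> {c - r<..<c + r}" for t
    by (simp add: \<phi>_def flat_quotient_def)
  have "{t. \<phi> t \<noteq> 0} = {c - r<..<c + r}"
    using pos nonneg by (auto simp: less_le)
  then have "closure {t. \<phi> t \<noteq> 0} = {c - r..c + r}"
    using \<open>0 < r\<close> by simp
  moreover have "(deriv ^^ n) \<phi> differentiable_on UNIV" for n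
  proof -
    obtain p k where "(deriv ^^ n) \<phi> = (\<lambda>x. poly p x * flat_quotient k (poly q x))"
      unfolding \<phi>_def using iterated_deriv_poly_flat_quotient by blast
    moreover have "(\<lambda>x. poly p x * flat_quotient k (poly q x)) differentiable at t" for t
      unfolding real_differentiable_def using DERIV_poly_flat_quotient by blast
    ultimately show ?thesis by (simp add: differentiable_on_def)
  qed
  ultimately show "\<phi> \<in> test_fun I" using assms by (simp add: test_fun_def del: compact_closure)
qed

section \<open>Properties of H\<close>

lemma H_continuous: "continuous_on ({0<..<1} - {1/2}) H"
proof -
  have "continuous_on ({0<..<1} - {1/2}) (\<lambda>t::real.
      - 2 / (t * (1 - t)) + 2 / min t (1 - t) * ln (4 * t * (1 - t) / (1 - 2 * t)\<^sup>2))"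
    by (intro continuous_intros) (auto simp: min_def)
  then show ?thesis by (simp add: H_def[abs_def] dI_def[abs_def])
qed

lemma H_symmetric: "H (1 - t) = H t"
proof -
  have "dI (1 - t) = dI t" by (simp add: dI_def min.commute)
  moreover have "(1 - 2 * (1 - t))\<^sup>2 = (1 - 2 * t)\<^sup>2" by (simp add: power2_eq_square algebra_simps)
  ultimately show ?thesis by (simp add: H_def mult_ac)
qed

lemma H_measurable[measurable]: "H \<in> borel_measurable borel"
  unfolding H_def[abs_def] dI_def[abs_def] by measurable

lemma U_measurable[measurable]: "U \<beta> \<in> borel_measurable borel"
  unfolding U_def[abs_def] dI_def[abs_def] by measurable

lemma eventually_dI_half:
  "\<forall>\<^sub>F t in at_left (1/2). dI t = t" "\<forall>\<^sub>F t in at_right (1/2). dI t = 1 - t"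
proof -
  have "\<forall>\<^sub>F t in at_left (1/2 :: real). t < 1/2" "\<forall>\<^sub>F t in at_right (1/2 :: real). t > 1/2"
    by (auto simp: eventually_at_filter)
  then show "\<forall>\<^sub>F t in at_left (1/2). dI t = t" "\<forall>\<^sub>F t in at_right (1/2). dI t = 1 - t"
    by (auto elim!: eventually_mono simp: dI_def)
qed

text \<open>At \<open>1/2\<close> the factor \<open>2 / dI t\<close> tends to \<open>4\<close> and the logarithm behaves like \<open>- ln ((1/2 - t)\<^sup>2)\<close>,
  while the other terms stay bounded. The two sides are treated separately because \<open>dI\<close> has a kink at \<open>1/2\<close>.\<close>

lemma H_asymp_equiv: "H \<sim>[at (1/2)] (\<lambda>t. - 4 * ln ((1/2 - t)\<^sup>2))"
proof -
  have "((\<lambda>t. H t / (- 4 * ln ((1/2 - t)\<^sup>2))) \<longlongrightarrow> 1) (at_left (1/2))"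
  proof (rule Lim_transform_eventually)
    show "((\<lambda>t::real. (- 2 / (t * (1 - t)) + 2 / t * ln (4 * t * (1 - t) / (1 - 2 * t)\<^sup>2))
         / (- 4 * ln ((1/2 - t)\<^sup>2))) \<longlongrightarrow> 1) (at_left (1/2))"
      by real_asymp
    show "\<forall>\<^sub>F t in at_left (1/2). (- 2 / (t * (1 - t)) + 2 / t * ln (4 * t * (1 - t) / (1 - 2 * t)\<^sup>2))
         / (- 4 * ln ((1/2 - t)\<^sup>2)) = H t / (- 4 * ln ((1/2 - t)\<^sup>2))"
      using eventually_dI_half(1) by eventually_elim (simp add: H_def)
  qed
  moreover have "((\<lambda>t. H t / (- 4 * ln ((1/2 - t)\<^sup>2))) \<longlongrightarrow> 1) (at_right (1/2))"
  proof (rule Lim_transform_eventually)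
    show "((\<lambda>t::real. (- 2 / (t * (1 - t)) + 2 / (1 - t) * ln (4 * t * (1 - t) / (1 - 2 * t)\<^sup>2))
         / (- 4 * ln ((1/2 - t)\<^sup>2))) \<longlongrightarrow> 1) (at_right (1/2))"
      by real_asymp
    show "\<forall>\<^sub>F t in at_right (1/2). (- 2 / (t * (1 - t)) + 2 / (1 - t) * ln (4 * t * (1 - t) / (1 - 2 * t)\<^sup>2))
         / (- 4 * ln ((1/2 - t)\<^sup>2)) = H t / (- 4 * ln ((1/2 - t)\<^sup>2))"
      using eventually_dI_half(2) by eventually_elim (simp add: H_def)
  qed
  ultimately have "((\<lambda>t. H t / (- 4 * ln ((1/2 - t)\<^sup>2))) \<longlongrightarrow> 1) (at (1/2))"
    by (simp add: filterlim_at_split)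
  then show ?thesis by (rule asymp_equivI')
qed

lemma H_at_top: "filterlim H at_top (at (1/2))"
proof -
  have "filterlim (\<lambda>t::real. - 4 * ln ((1/2 - t)\<^sup>2)) at_top (at (1/2))"
    by real_asymp
  then show ?thesis
    using asymp_equiv_at_top_transfer[OF asymp_equiv_symI[OF H_asymp_equiv]] by simp
qed

text \<open>The singular term has the sign of \<open>\<beta> * H\<close>; all other factors have finite limits at \<open>1/2\<close>.\<close>

lemma rhs_at_bot:
  assumes "\<beta> < 0"
  shows "filterlim (\<lambda>t. \<beta> * H t * U \<beta> t + 2 / (t * (1 - t)) * U \<beta> t) at_bot (at (1/2))"
proof -
  let ?u = "\<lambda>t. dI t powr \<beta>"
  have d: "(dI \<longlongrightarrow> 1/2) (at (1/2))"
    unfolding dI_def[abs_def] by (auto intro!: tendsto_eq_intros)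
  have u: "(?u \<longlongrightarrow> (1/2) powr \<beta>) (at (1/2))"
    by (intro tendsto_intros d) auto
  have g: "((\<lambda>t::real. 2 / (t * (1 - t))) \<longlongrightarrow> 8) (at (1/2))"
    by (auto intro!: tendsto_eq_intros)
  have "filterlim (\<lambda>t. - (\<beta> * H t)) at_top (at (1/2))"
    using filterlim_tendsto_pos_mult_at_top[OF tendsto_const[of "-\<beta>"] _ H_at_top] assms by simp
  then have "filterlim (\<lambda>t. - (\<beta> * H t) * ?u t) at_top (at (1/2))"
    by (rule filterlim_at_top_mult_tendsto_pos[OF u, rotated]) simp
  then have "filterlim (\<lambda>t. - (2 / (t * (1 - t)) * ?u t) + - (\<beta> * H t) * ?u t) at_top (at (1/2))"
    by (rule filterlim_tendsto_add_at_top[OF tendsto_minus[OF tendsto_mult[OF g u]]])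
  then have "filterlim (\<lambda>t. - (- (2 / (t * (1 - t)) * ?u t) + - (\<beta> * H t) * ?u t)) at_bot (at (1/2))"
    by (rule filterlim_compose[OF filterlim_uminus_at_bot_at_top])
  moreover have "\<forall>\<^sub>F t in at (1/2::real). t \<in> {0<..<1}"
    by (rule eventually_at_in_open') auto
  then have "\<forall>\<^sub>F t in at (1/2). - (- (2 / (t * (1 - t)) * ?u t) + - (\<beta> * H t) * ?u t) =
      \<beta> * H t * U \<beta> t + 2 / (t * (1 - t)) * U \<beta> t"
    by eventually_elim (simp add: U_def)
  ultimately show ?thesis
    by (subst (asm) filterlim_cong[OF refl refl])
qed

lemma compact_subset_unit_interval:
  fixes K :: "real set"
  assumes "compact K" "K \<subseteq> {0<..<1}"
  obtains a where "0 < a" "a < 1/2" "K \<subseteq> {a..1 - a}"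
proof (cases "K = {}")
  case True
  then show ?thesis using that[of "1/4"] by simp
next
  case False
  obtain l where l: "l \<in> K" "\<And>x. x \<in> K \<Longrightarrow> l \<le> x" using compact_attains_inf[OF assms(1) False] by blast
  obtain u where u: "u \<in> K" "\<And>x. x \<in> K \<Longrightarrow> x \<le> u" using compact_attains_sup[OF assms(1) False] by blast
  show ?thesis
    by (rule that[of "min (min l (1 - u)) (1/4)"]) (use l u assms(2) in \<open>force simp: min_def\<close>)+
qed

text \<open>On compact subsets of the interval the only singularity of \<open>H\<close> is the logarithmic one at \<open>1/2\<close>.\<close>

lemma abs_H_le:
  assumes a: "0 < a" "a < 1/2"
  obtains C where "0 \<le> C" "\<And>t. t \<in> {a..1 - a} \<Longrightarrow> \<bar>H t\<bar> \<le> C * (1 + \<bar>ln \<bar>t - 1/2\<bar>\<bar>)"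
proof
  define A where "A = 2 / a\<^sup>2 + 4 * \<bar>ln a\<bar> / a + 4 / a"
  show "0 \<le> A" using a unfolding A_def by (intro add_nonneg_nonneg divide_nonneg_nonneg) (use a in auto)
  fix t assume t: "t \<in> {a..1 - a}"
  have s: "a * a \<le> t * (1 - t)" using t a by (intro mult_mono) auto
  have d: "a \<le> dI t" using t a by (simp add: dI_def)
  have "\<bar>- 2 / (t * (1 - t))\<bar> \<le> 2 / a\<^sup>2"
    using s t a by (simp add: abs_divide power2_eq_square abs_mult frac_le)
  moreover have "\<bar>2 / dI t * ln (4 * t * (1 - t) / (1 - 2 * t)\<^sup>2)\<bar> \<le> 2 / a * (2 * \<bar>ln a\<bar> + 2 * \<bar>ln \<bar>t - 1/2\<bar>\<bar>)"
  proof (cases "t = 1/2")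
    case False
    have eq: "4 * t * (1 - t) / (1 - 2 * t)\<^sup>2 = t * (1 - t) / \<bar>t - 1/2\<bar>\<^sup>2"
      using False by (simp add: divide_simps power2_eq_square) (simp add: algebra_simps)
    have pos: "0 < \<bar>t - 1/2\<bar>" using False by simp
    have "ln (4 * t * (1 - t) / (1 - 2 * t)\<^sup>2) = ln t + ln (1 - t) - 2 * ln \<bar>t - 1/2\<bar>"
      unfolding eq
    proof -
      have "ln (t * (1 - t) / x\<^sup>2) = ln t + ln (1 - t) - 2 * ln x" if "0 < x" for x
        using t a that by (simp add: ln_div ln_mult ln_realpow)
      then show "ln (t * (1 - t) / \<bar>t - 1/2\<bar>\<^sup>2) = ln t + ln (1 - t) - 2 * ln \<bar>t - 1/2\<bar>"
        using pos .
    qed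
    moreover have "\<bar>ln t\<bar> \<le> \<bar>ln a\<bar>" "\<bar>ln (1 - t)\<bar> \<le> \<bar>ln a\<bar>" using t a by simp_all
    ultimately have "\<bar>ln (4 * t * (1 - t) / (1 - 2 * t)\<^sup>2)\<bar> \<le> 2 * \<bar>ln a\<bar> + 2 * \<bar>ln \<bar>t - 1/2\<bar>\<bar>"
      by linarith
    moreover have "\<bar>2 / dI t\<bar> \<le> 2 / a" using d a by (simp add: frac_le)
    ultimately show ?thesis unfolding abs_mult using a by (intro mult_mono) auto
  next
    case True
    have "0 \<le> 2 / a * (2 * \<bar>ln a\<bar> + 2 * \<bar>ln \<bar>t - 1/2\<bar>\<bar>)"
      by (intro mult_nonneg_nonneg add_nonneg_nonneg) (use a in auto)
    moreover have "(1 - 2 * t)\<^sup>2 = 0" using True by simp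
    ultimately show ?thesis by (simp only: div_by_0 ln_0 mult_zero_right abs_zero)
  qed
  ultimately have "\<bar>H t\<bar> \<le> 2 / a\<^sup>2 + 2 / a * (2 * \<bar>ln a\<bar> + 2 * \<bar>ln \<bar>t - 1/2\<bar>\<bar>)"
    unfolding H_def by linarith
  also have "\<dots> \<le> A * (1 + \<bar>ln \<bar>t - 1/2\<bar>\<bar>)"
  proof -
    have "0 \<le> (2 / a\<^sup>2 + 4 * \<bar>ln a\<bar> / a) * \<bar>ln \<bar>t - 1/2\<bar>\<bar>" "0 \<le> 4 / a"
      by (intro mult_nonneg_nonneg add_nonneg_nonneg divide_nonneg_nonneg; use a in simp)+
    then show ?thesis by (simp add: A_def algebra_simps)
  qed
  finally show "\<bar>H t\<bar> \<le> A * (1 + \<bar>ln \<bar>t - 1/2\<bar>\<bar>)" .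
qed

lemma set_integrable_powr_center:
  assumes "-1 < r"
  shows "set_integrable lborel {0<..<1} (\<lambda>t::real. \<bar>t - 1/2\<bar> powr r)"
proof -
  have "(\<lambda>x::real. -(1/2) + 1 * x) -` {0<..<1/2} = {1/2<..<1}" "(\<lambda>x::real. 1/2 + (-1) * x) -` {0<..<1/2} = {0<..<1/2}"
    by auto
  with set_integrable_affine[OF _ set_integrable_powr[OF assms], of 1 "-(1/2)" "1/2"]
       set_integrable_affine[OF _ set_integrable_powr[OF assms], of "-1" "1/2" "1/2"]
  have *: "set_integrable lborel {1/2<..<1} (\<lambda>t::real. (t - 1/2) powr r)"
          "set_integrable lborel {0<..<1/2} (\<lambda>t::real. (1/2 - t) powr r)"
    by simp_all
  have "set_integrable lborel ({1/2<..<1} \<union> {0<..<1/2}) (\<lambda>t::real. \<bar>t - 1/2\<bar> powr r)"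
    by (rule set_integrable_Un; (rule set_integrable_cong[THEN iffD1, OF refl refl _ *(1)] set_integrable_cong[THEN iffD1, OF refl refl _ *(2)])?; simp)
  then show ?thesis
    by (rule set_integrable_discrete_difference[where X = "{1/2}", THEN iffD1, rotated -1]) auto
qed

text \<open>The logarithm is dominated by the power \<open>\<bar>t - 1/2\<bar> powr (- r)\<close> for every positive \<open>r\<close>. With \<open>r = 1 / (2 * q)\<close>
  the \<open>q\<close>-th power of this bound is \<open>\<bar>t - 1/2\<bar> powr (- 1/2)\<close>, which is integrable.\<close>

lemma H_Lq_loc:
  assumes "1 \<le> q"
  shows "H \<in> Lq_loc q {0<..<1}"
  unfolding Lq_loc_def
proof (intro CollectI allI impI conjI)
  fix K :: "real set" assume K: "compact K \<and> K \<subseteq> {0<..<1}"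
  have [measurable]: "K \<in> sets borel" using K by (auto intro: borel_compact)
  show "set_borel_measurable lebesgue K H"
    unfolding set_borel_measurable_def
    by (rule measurable_completion) measurable
  obtain a where a: "0 < a" "a < 1/2" "K \<subseteq> {a..1 - a}"
    using compact_subset_unit_interval K by blast
  obtain C where C: "0 \<le> C" "\<And>t. t \<in> {a..1 - a} \<Longrightarrow> \<bar>H t\<bar> \<le> C * (1 + \<bar>ln \<bar>t - 1/2\<bar>\<bar>)"
    using abs_H_le[OF a(1,2)] by metis
  define r where "r = 1 / (2 * q)"
  have r: "0 < r" "r * q = 1/2" using assms by (auto simp: r_def)
  let ?D = "(C * (1 + 1 / r)) powr q"
  have "set_integrable lborel K (\<lambda>t. \<bar>H t\<bar> powr q)"
  proof (rule set_integrable_bound)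
    show "set_integrable lborel K (\<lambda>t. ?D * \<bar>t - 1/2\<bar> powr (-1/2))"
      using set_integrable_subset[OF set_integrable_powr_center[of "-1/2"], of K] K by simp
    show "set_borel_measurable lborel K (\<lambda>t. \<bar>H t\<bar> powr q)"
      unfolding set_borel_measurable_def by measurable
    have bound: "\<bar>H t\<bar> powr q \<le> ?D * \<bar>t - 1/2\<bar> powr (-1/2)" if t: "t \<in> K" "t \<noteq> 1/2" for t
    proof -
      define x where "x = \<bar>t - 1/2\<bar>"
      have x: "0 < x" "x \<le> 1" using t K by (auto simp: x_def abs_if)
      have "1 \<le> x powr (- r)" using x r by (simp add: ge_one_powr_ge_zero powr_minus powr_le1 one_le_inverse_iff)
      then have "1 + \<bar>ln x\<bar> \<le> x powr (- r) + x powr (-r) / r"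
        using abs_ln_le_powr[OF x r(1)] by linarith
      then have "\<bar>H t\<bar> \<le> C * ((1 + 1 / r) * x powr (- r))"
        using C(2)[of t] a t C(1) unfolding x_def[symmetric]
        by (intro order_trans[OF C(2)[of t, folded x_def]] mult_left_mono) (auto simp: algebra_simps)
      then have "\<bar>H t\<bar> powr q \<le> (C * (1 + 1 / r) * x powr (- r)) powr q"
        using assms by (intro powr_mono2) (auto simp: mult_ac)
      also have "\<dots> = ?D * x powr (- r * q)"
        using C(1) r(1) x by (simp add: powr_mult powr_powr)
      also have "- r * q = -1/2" using r(2) by simp
      finally show ?thesis by (simp add: x_def)
    qed
    have bound': "norm (\<bar>H t\<bar> powr q) \<le> norm (?D * \<bar>t - 1/2\<bar> powr (-1/2))" if "t \<in> K" "t \<noteq> 1/2" for t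
      using order_trans[OF bound[OF that] abs_ge_self] by simp
    show "AE t in lborel. t \<in> K \<longrightarrow> norm (\<bar>H t\<bar> powr q) \<le> norm (?D * \<bar>t - 1/2\<bar> powr (-1/2))"
      using AE_lborel_singleton[of "1/2::real"] by eventually_elim (use bound' in blast)
  qed
  then show "set_integrable lebesgue K (\<lambda>t. \<bar>H t\<bar> powr q)"
    unfolding set_integrable_def by (subst integrable_completion) (auto dest: borel_measurable_integrable)
qed

section \<open>Convexity and test functions\<close>

text \<open>The graph of a power with nonpositive exponent lies above its tangents. With \<open>s = z / x\<close> this
  is \<open>s powr b = exp (b * ln s) \<ge> 1 + b * ln s \<ge> 1 + b * (s - 1)\<close>, rescaled by \<open>x powr b\<close>.\<close>

lemma powr_above_tangent:
  fixes x z b :: real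
  assumes "0 < x" "0 < z" "b \<le> 0"
  shows "x powr b - z powr b \<le> b * x powr (b - 1) * (x - z)"
proof -
  have "ln (z / x) \<le> z / x - 1" using assms by (intro ln_le_minus_one) simp
  then have "b * (z / x - 1) \<le> b * ln (z / x)" using assms by (intro mult_left_mono_neg)
  moreover have "1 + b * ln (z / x) \<le> (z / x) powr b"
    using exp_ge_add_one_self[of "b * ln (z / x)"] assms by (simp add: powr_def)
  ultimately have "x powr b * (1 + b * (z / x - 1)) \<le> x powr b * (z / x) powr b"
    by (intro mult_left_mono) auto
  also have "\<dots> = z powr b" using assms by (simp flip: powr_mult)
  finally have "x powr b + b * (x powr b / x) * (z - x) \<le> z powr b"
    using assms by (simp add: field_simps)
  moreover have "x powr b / x = x powr (b - 1)" using assms by (simp add: powr_diff)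
  ultimately show ?thesis by (simp add: algebra_simps)
qed

lemma powr_lipschitz:
  fixes x z b c :: real
  assumes "0 < c" "c \<le> x" "c \<le> z" "b \<le> 0"
  shows "\<bar>x powr b - z powr b\<bar> \<le> - b * c powr (b - 1) * \<bar>x - z\<bar>"
proof -
  have half: "u powr b - v powr b \<le> - b * c powr (b - 1) * \<bar>u - v\<bar>" if "c \<le> u" "c \<le> v" for u v
  proof -
    have "u powr b - v powr b \<le> b * u powr (b - 1) * (u - v)"
      using assms that by (intro powr_above_tangent) auto
    also have "\<dots> \<le> \<bar>b * u powr (b - 1) * (u - v)\<bar>" by simp
    also have "\<dots> = - b * u powr (b - 1) * \<bar>u - v\<bar>" using assms by (simp add: abs_mult)
    also have "\<dots> \<le> - b * c powr (b - 1) * \<bar>u - v\<bar>"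
      using assms that by (intro mult_right_mono mult_left_mono powr_mono2') auto
    finally show ?thesis .
  qed
  show ?thesis using half[of x z] half[of z x] assms by (auto simp: abs_le_iff abs_minus_commute)
qed

text \<open>A test function enters the estimates only through these data: a support kept away from the endpoints, a
  Lipschitz constant and a bound.\<close>

lemma test_fun_unit_interval:
  assumes "\<phi> \<in> test_fun {0<..<1}"
  obtains a L M where "0 < a" "a < 1/2" "\<And>t. t \<notin> {a..1 - a} \<Longrightarrow> \<phi> t = 0"
    "L-lipschitz_on UNIV \<phi>" "0 < M" "\<And>t. \<bar>\<phi> t\<bar> \<le> M"
proof -
  have diff: "(deriv ^^ n) \<phi> differentiable_on UNIV" for n
    using assms by (auto simp: test_fun_def)
  have supp: "compact (closure {t. \<phi> t \<noteq> 0})" "closure {t. \<phi> t \<noteq> 0} \<subseteq> {0<..<1}"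
    using assms by (auto simp: test_fun_def simp del: compact_closure)
  obtain a where a: "0 < a" "a < 1/2" "closure {t. \<phi> t \<noteq> 0} \<subseteq> {a..1 - a}"
    using compact_subset_unit_interval[OF supp] by blast
  have zero: "\<phi> t = 0" if "t \<notin> {a..1 - a}" for t
    using that a(3) closure_subset[of "{t. \<phi> t \<noteq> 0}"] by blast
  have D: "(\<phi> has_real_derivative deriv \<phi> t) (at t)" for t
    using diff[of 0] by (simp add: differentiable_on_def DERIV_deriv_iff_real_differentiable)
  have "continuous_on UNIV (deriv \<phi>)"
    using diff[of 1] by (intro differentiable_imp_continuous_on) simp
  then have "compact (deriv \<phi> ` {0..1})"
    by (intro compact_continuous_image continuous_on_subset[where s = UNIV and t = "{0..1}"]) auto
  then have "bounded (deriv \<phi> ` {0..1})" by (rule compact_imp_bounded)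
  then obtain L where L: "0 < L" "\<And>t. t \<in> {0..1} \<Longrightarrow> \<bar>deriv \<phi> t\<bar> \<le> L"
    by (auto simp: bounded_pos)
  \<comment> \<open>Clamping to the closed interval does not change the values of \<open>\<phi>\<close>, so a Lipschitz constant on
    \<open>[0, 1]\<close> is one on the whole line.\<close>
  define cl where "cl t = max 0 (min 1 t)" for t :: real
  have cl: "\<phi> (cl t) = \<phi> t" "cl t \<in> {0..1}" "\<bar>cl t - cl y\<bar> \<le> \<bar>t - y\<bar>" for t y
    using zero[of 0] zero[of 1] zero[of t] a by (auto simp: cl_def min_def max_def)
  have "\<bar>\<phi> t - \<phi> y\<bar> \<le> L * \<bar>t - y\<bar>" for t y
  proof -
    have "norm (\<phi> (cl t) - \<phi> (cl y)) \<le> L * norm (cl t - cl y)"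
      using L(2) cl(2) by (intro field_differentiable_bound[where S = "{0..1}" and f' = "deriv \<phi>"])
        (auto intro: DERIV_subset[OF D])
    also have "\<dots> \<le> L * \<bar>t - y\<bar>" using L cl(3) by (intro mult_left_mono) auto
    finally show ?thesis by (simp add: cl(1))
  qed
  then have lip: "L-lipschitz_on UNIV \<phi>" using L(1) by (intro lipschitz_onI) (auto simp: dist_real_def)
  have "\<bar>\<phi> t\<bar> \<le> L" for t
  proof -
    have "\<bar>\<phi> (cl t) - \<phi> 0\<bar> \<le> L * \<bar>cl t - 0\<bar>"
      using lipschitz_onD[OF lip, of "cl t" 0] by (simp add: dist_real_def)
    also have "\<dots> \<le> L * 1" using L(1) cl(2)[of t] by (intro mult_left_mono) auto
    finally show ?thesis using zero[of 0] a by (simp add: cl(1))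
  qed
  with that[OF a(1,2) zero lip L(1)] show thesis by blast
qed

lemma set_integrable_U:
  assumes "-1 < \<beta>"
  shows "set_integrable lborel {0<..<1} (U \<beta>)"
proof (rule set_integrable_bound)
  have "(\<lambda>x::real. 1 - x) -` {0<..<1} = {0<..<1}" by auto
  then have "set_integrable lborel {0<..<1} (\<lambda>t::real. (1 - t) powr \<beta>)"
    using set_integrable_reflect[OF set_integrable_powr[OF assms, of 1], of 1] by simp
  then show "set_integrable lborel {0<..<1} (\<lambda>t::real. t powr \<beta> + (1 - t) powr \<beta>)"
    by (rule set_integral_add(1)[OF set_integrable_powr[OF assms]])
  show "set_borel_measurable lborel {0<..<1} (U \<beta>)"
    unfolding set_borel_measurable_def by measurable
  show "AE t in lborel. t \<in> {0<..<1} \<longrightarrow> norm (U \<beta> t) \<le> norm (t powr \<beta> + (1 - t) powr \<beta>)"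
    by (intro AE_I2) (auto simp: U_def dI_def min_def)
qed

lemma integral_inverse_square:
  fixes c :: real
  assumes "0 < c"
  shows "set_integrable lborel {c..} (\<lambda>x. 1 / x\<^sup>2)" "(LINT x:{c..}|lborel. 1 / x\<^sup>2) = 1 / c"
proof -
  have "(\<integral>\<^sup>+ x. ennreal (1 / x\<^sup>2) * indicator {c..} x \<partial>lborel) = ennreal (0 - (- (1 / c)))"
  proof (rule nn_integral_FTC_atLeast)
    show "((\<lambda>x. - (1 / x)) has_real_derivative 1 / x\<^sup>2) (at x)" if "c \<le> x" for x :: real
      using that assms by (auto intro!: derivative_eq_intros simp: power2_eq_square)
    have "((\<lambda>x::real. 1 / x) \<longlongrightarrow> 0) at_top"
      using tendsto_inverse_0_at_top[OF filterlim_ident] by (simp add: inverse_eq_divide)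
    from tendsto_minus[OF this] show "((\<lambda>x::real. - (1 / x)) \<longlongrightarrow> 0) at_top" by simp
  qed auto
  moreover have "ennreal (1 / x\<^sup>2) * indicator {c..} x = ennreal (indicator {c..} x *\<^sub>R (1 / x\<^sup>2))" for x :: real
    by (simp add: indicator_def)
  ultimately have "has_bochner_integral lborel (\<lambda>x. indicator {c..} x *\<^sub>R (1 / x\<^sup>2)) (1 / c)"
    using assms by (intro has_bochner_integral_nn_integral) auto
  then show "set_integrable lborel {c..} (\<lambda>x. 1 / x\<^sup>2)" "(LINT x:{c..}|lborel. 1 / x\<^sup>2) = 1 / c"
    by (auto simp: set_integrable_def set_lebesgue_integral_def has_bochner_integral_iff)
qed

lemma integral_inverse_square_outside:
  fixes t :: real
  assumes t: "t \<in> {0<..<1}"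
  shows "set_integrable lborel (- {0<..<1}) (\<lambda>y. 1 / (t - y)\<^sup>2)"
    and "(LINT y:- {0<..<1}|lborel. 1 / (t - y)\<^sup>2) = 1 / (t * (1 - t))"
proof -
  have left: "set_integrable lborel {..0} (\<lambda>y. 1 / (c - y)\<^sup>2)"
      "(LINT y:{..0}|lborel. 1 / (c - y)\<^sup>2) = 1 / c" if "0 < c" for c :: real
  proof -
    have eq: "(\<lambda>y. c - y) -` {c..} = {..0}" by auto
    show "set_integrable lborel {..0} (\<lambda>y. 1 / (c - y)\<^sup>2)"
      using set_integrable_reflect[OF integral_inverse_square(1)[OF that], of c] by (simp add: eq)
    show "(LINT y:{..0}|lborel. 1 / (c - y)\<^sup>2) = 1 / c"
      using set_integral_reflect[of "{c..}" "\<lambda>x. 1 / x\<^sup>2" c] integral_inverse_square(2)[OF that] by (simp add: eq)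
  qed
  have right: "set_integrable lborel {1..} (\<lambda>y. 1 / (t - y)\<^sup>2)"
      "(LINT y:{1..}|lborel. 1 / (t - y)\<^sup>2) = 1 / (1 - t)"
  proof -
    have eq: "(\<lambda>y::real. 1 - y) -` {..0} = {1..}" by auto
    have sq: "(1 - t - (1 - y))\<^sup>2 = (t - y)\<^sup>2" for y by (simp add: power2_eq_square algebra_simps)
    show "set_integrable lborel {1..} (\<lambda>y. 1 / (t - y)\<^sup>2)"
      using set_integrable_reflect[OF left(1)[of "1 - t"], of 1] t unfolding sq eq by simp
    show "(LINT y:{1..}|lborel. 1 / (t - y)\<^sup>2) = 1 / (1 - t)"
      using set_integral_reflect[of "{..0}" "\<lambda>y. 1 / (1 - t - y)\<^sup>2" 1] left(2)[of "1 - t"] t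
      unfolding sq eq by simp
  qed
  have split: "- {0<..<1} = {..0} \<union> {1 :: real..}" by auto
  show "set_integrable lborel (- {0<..<1}) (\<lambda>y. 1 / (t - y)\<^sup>2)"
    unfolding split using left(1)[of t] right(1) t by (intro set_integrable_Un) auto
  have "(LINT y:- {0<..<1}|lborel. 1 / (t - y)\<^sup>2) = 1 / t + 1 / (1 - t)"
    unfolding split using left[of t] right t by (subst set_integral_Un) auto
  also have "\<dots> = 1 / (t * (1 - t))" using t by (simp add: field_simps)
  finally show "(LINT y:- {0<..<1}|lborel. 1 / (t - y)\<^sup>2) = 1 / (t * (1 - t))" .
qed

section \<open>The weak inequality\<close>

lemma U_ge_1: "\<beta> \<le> 0 \<Longrightarrow> t \<in> {0<..<1} \<Longrightarrow> 1 \<le> U \<beta> t"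
  using powr_mono2'[of \<beta> "dI t" 1] by (auto simp: U_def dI_def min_def)

lemma U_nonneg: "0 \<le> U \<beta> t"
  by (simp add: U_def)

lemma continuous_lipschitz_measurable:
  fixes \<phi> :: "real \<Rightarrow> real"
  assumes "L-lipschitz_on UNIV \<phi>"
  shows "\<phi> \<in> borel_measurable borel"
  using lipschitz_on_continuous_on[OF assms] by (rule borel_measurable_continuous_onI)

lemma gagliardo_integrand_measurable:
  assumes [measurable]: "\<phi> \<in> borel_measurable borel"
  shows "gagliardo_integrand (U \<beta>) \<phi> \<in> borel_measurable borel"
  unfolding gagliardo_integrand_def by (rule borel_measurable_planeI) measurable

lemma set_integrable_sum_U:
  assumes "-1 < \<beta>"
  shows "set_integrable lborel ({0<..<1} \<times> {0<..<1}) (\<lambda>(t, y). U \<beta> t + U \<beta> y)"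
proof -
  have "set_integrable lborel ({0<..<1} \<times> {0<..<1}) (\<lambda>(t, y :: real). U \<beta> t)"
  proof (rule set_integrable_plane_Tonelli)
    show "(\<lambda>(t, y :: real). U \<beta> t) \<in> borel_measurable borel"
      by (rule borel_measurable_planeI) measurable
    show "set_integrable lborel {0<..<1} (\<lambda>y. case (t, y) of (t, y :: real) \<Rightarrow> U \<beta> t)" for t
      by (simp add: set_integrable_def)
    have "(LINT y:{0<..<1::real}|lborel. U \<beta> t) = U \<beta> t" for t
      by (simp add: set_lebesgue_integral_def)
    then show "set_integrable lborel {0<..<1} (\<lambda>t. LINT y:{0<..<1}|lborel. case (t, y) of (t, y :: real) \<Rightarrow> U \<beta> t)"
      using set_integrable_U[OF assms] by simp
  qed (auto simp: U_nonneg)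
  from set_integral_add(1)[OF this set_integral_plane_swap(1)[OF this]]
  show ?thesis by (simp add: case_prod_unfold)
qed

lemma gagliardo_integrand_sym: "gagliardo_integrand u \<phi> (y, t) = gagliardo_integrand u \<phi> (t, y)"
  unfolding gagliardo_integrand_def prod.case abs_minus_commute[of y t] by (simp add: algebra_simps)

text \<open>Where \<open>t\<close> and \<open>y\<close> are close and one of them lies in the support of \<open>\<phi>\<close>, both stay away from the endpoints, \<open>U\<close> is
  Lipschitz there, and the integrand is bounded. Where they are at distance at least \<open>a / 2\<close> the kernel is bounded, and
  the growth of \<open>U\<close> at the endpoints is integrable because \<open>\<beta> > -1\<close>. Since \<open>U \<ge> 1\<close> on the interval, a
  multiple of \<open>U t + U y\<close> dominates in both cases.\<close>

lemma gagliardo_integrable_square: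
  assumes \<beta>: "-1 < \<beta>" "\<beta> < 0"
    and a: "0 < a" "a < 1/2" "\<And>t. t \<notin> {a..1 - a} \<Longrightarrow> \<phi> t = 0"
    and lip: "L-lipschitz_on UNIV \<phi>" and M: "0 < M" "\<And>t. \<bar>\<phi> t\<bar> \<le> M"
  shows "set_integrable lborel ({0<..<1} \<times> {0<..<1}) (gagliardo_integrand (U \<beta>) \<phi>)"
proof (rule set_integrable_bound)
  let ?I = "{0<..<1} :: real set" and ?E = "gagliardo_integrand (U \<beta>) \<phi>"
  define B where "B = - \<beta> * (a / 2) powr (\<beta> - 1)"
  define C where "C = B * L + 2 * M / (a / 2)\<^sup>2"
  have L: "0 \<le> L" using lip by (rule lipschitz_on_nonneg)
  have B: "0 \<le> B" unfolding B_def using \<beta> by (intro mult_nonneg_nonneg) auto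
  have \<phi>_lip: "\<bar>\<phi> t - \<phi> y\<bar> \<le> L * \<bar>t - y\<bar>" for t y
    using lipschitz_onD[OF lip, of t y] by (simp add: dist_real_def)
  have main: "\<bar>?E (t, y)\<bar> \<le> C * (U \<beta> t + U \<beta> y)" if t: "t \<in> {a..1 - a}" and y: "y \<in> ?I" for t y
  proof (cases "\<bar>t - y\<bar> < a / 2")
    case True
    then have "t - y < a / 2" "y - t < a / 2" by linarith+
    then have "a / 2 \<le> dI t" "a / 2 \<le> dI y" using t a(1,2) by (auto simp: dI_def)
    then have "\<bar>dI t powr \<beta> - dI y powr \<beta>\<bar> \<le> B * \<bar>dI t - dI y\<bar>"
      unfolding B_def using a \<beta> by (intro powr_lipschitz) auto
    also have "\<dots> \<le> B * \<bar>t - y\<bar>" using B dI_lipschitz by (intro mult_left_mono)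
    finally have "\<bar>U \<beta> t - U \<beta> y\<bar> \<le> B * \<bar>t - y\<bar>" using t y a by (simp add: U_def)
    then have "\<bar>U \<beta> t - U \<beta> y\<bar> * \<bar>\<phi> t - \<phi> y\<bar> \<le> (B * \<bar>t - y\<bar>) * (L * \<bar>t - y\<bar>)"
      using \<phi>_lip B by (intro mult_mono) auto
    also have "\<dots> = B * L * \<bar>t - y\<bar>\<^sup>2" by (simp add: power2_eq_square del: abs_mult_self_eq)
    finally have "\<bar>?E (t, y)\<bar> \<le> B * L"
      using B L by (cases "t = y") (simp_all add: gagliardo_integrand_def abs_divide abs_mult divide_le_eq)
    also have "\<dots> \<le> C * 1" using M a by (simp add: C_def)
    also have "\<dots> \<le> C * (U \<beta> t + U \<beta> y)"
      using U_ge_1[of \<beta> t] U_nonneg[of \<beta> y] t a \<beta> B L M by (intro mult_left_mono) (auto simp: C_def)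
    finally show ?thesis .
  next
    case False
    have "\<bar>U \<beta> t - U \<beta> y\<bar> \<le> U \<beta> t + U \<beta> y" using U_nonneg[of \<beta> t] U_nonneg[of \<beta> y] by linarith
    moreover have "\<bar>\<phi> t - \<phi> y\<bar> \<le> 2 * M" using M(2)[of t] M(2)[of y] by linarith
    ultimately have "\<bar>U \<beta> t - U \<beta> y\<bar> * \<bar>\<phi> t - \<phi> y\<bar> \<le> (U \<beta> t + U \<beta> y) * (2 * M)"
      using U_nonneg[of \<beta> t] U_nonneg[of \<beta> y] by (intro mult_mono) auto
    moreover have "(a / 2)\<^sup>2 \<le> \<bar>t - y\<bar>\<^sup>2" using False a by (intro power_mono) auto
    ultimately have "\<bar>U \<beta> t - U \<beta> y\<bar> * \<bar>\<phi> t - \<phi> y\<bar> / \<bar>t - y\<bar>\<^sup>2 \<le> (U \<beta> t + U \<beta> y) * (2 * M) / (a / 2)\<^sup>2"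
      using a M U_nonneg[of \<beta> t] U_nonneg[of \<beta> y] by (intro frac_le) auto
    then have "\<bar>?E (t, y)\<bar> \<le> (2 * M / (a / 2)\<^sup>2) * (U \<beta> t + U \<beta> y)"
      by (simp add: gagliardo_integrand_def abs_mult mult_ac)
    also have "\<dots> \<le> C * (U \<beta> t + U \<beta> y)"
      using B L U_nonneg[of \<beta> t] U_nonneg[of \<beta> y] by (intro mult_right_mono) (auto simp: C_def)
    finally show ?thesis .
  qed
  have C: "0 \<le> C" using B L M by (simp add: C_def)
  have bound: "\<bar>?E (t, y)\<bar> \<le> C * (U \<beta> t + U \<beta> y)" if "t \<in> ?I" "y \<in> ?I" for t y
  proof -
    consider "t \<in> {a..1 - a}" | "y \<in> {a..1 - a}" | "\<phi> t = 0" "\<phi> y = 0" using a(3) by blast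
    then show ?thesis
    proof cases
      case 1 then show ?thesis using main that by blast
    next
      case 2 then show ?thesis using main[of y t] that by (simp add: gagliardo_integrand_sym[of _ _ t y] add.commute)
    next
      case 3 then show ?thesis using C U_nonneg[of \<beta> t] U_nonneg[of \<beta> y] by (simp add: gagliardo_integrand_def)
    qed
  qed
  show "set_integrable lborel (?I \<times> ?I) (\<lambda>z. C * (case z of (t, y) \<Rightarrow> U \<beta> t + U \<beta> y))"
    using set_integrable_sum_U[OF \<beta>(1)] by simp
  have meas: "?E \<in> borel_measurable borel"
    by (rule gagliardo_integrand_measurable[OF continuous_lipschitz_measurable[OF lip]])
  show "set_borel_measurable lborel (?I \<times> ?I) ?E"
    unfolding set_borel_measurable_def using meas
    by (intro borel_measurable_scaleR borel_measurable_indicator) (auto intro: borel_Times)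
  have "norm (?E z) \<le> norm (C * (case z of (t, y) \<Rightarrow> U \<beta> t + U \<beta> y))" if "z \<in> ?I \<times> ?I" for z
  proof -
    obtain t y where z: "z = (t, y)" "t \<in> ?I" "y \<in> ?I" using \<open>z \<in> ?I \<times> ?I\<close> by blast
    show ?thesis using order_trans[OF bound[OF z(2,3)] abs_ge_self] by (simp add: z(1))
  qed
  then show "AE z in lborel. z \<in> ?I \<times> ?I \<longrightarrow> norm (?E z) \<le> norm (C * (case z of (t, y) \<Rightarrow> U \<beta> t + U \<beta> y))"
    by (intro AE_I2 impI)
qed

text \<open>For \<open>y\<close> outside the interval both \<open>U\<close> and \<open>\<phi>\<close> vanish at \<open>y\<close>, and \<open>1 / (t - y)\<^sup>2\<close> integrates to
  \<open>1 / t + 1 / (1 - t) = 1 / (t * (1 - t))\<close>. This is the source of the potential term in the inequality.\<close>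

lemma gagliardo_outside:
  assumes \<beta>: "-1 < \<beta>"
    and a: "0 < a" "a < 1/2" "\<And>t. t \<notin> {a..1 - a} \<Longrightarrow> \<phi> t = 0"
    and nonneg: "\<And>t. 0 \<le> \<phi> t" and [measurable]: "\<phi> \<in> borel_measurable borel"
    and M: "\<And>t. \<bar>\<phi> t\<bar> \<le> M"
  shows "set_integrable lborel {0<..<1} (\<lambda>t. 1 / (t * (1 - t)) * U \<beta> t * \<phi> t)"
    and "set_integrable lborel ({0<..<1} \<times> - {0<..<1}) (gagliardo_integrand (U \<beta>) \<phi>)"
    and "(LINT z:{0<..<1} \<times> - {0<..<1}|lborel. gagliardo_integrand (U \<beta>) \<phi> z) =
      (LINT t:{0<..<1}|lborel. 1 / (t * (1 - t)) * U \<beta> t * \<phi> t)"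
proof -
  let ?I = "{0<..<1} :: real set" and ?E = "gagliardo_integrand (U \<beta>) \<phi>"
  have "set_integrable lborel ?I (\<lambda>t. \<phi> t / (t * (1 - t)) * U \<beta> t)"
  proof (rule set_integrable_mult_bounded[OF set_integrable_U[OF \<beta>]])
    fix t :: real
    show "\<bar>\<phi> t / (t * (1 - t))\<bar> \<le> M / (a * a)"
    proof (cases "t \<in> {a..1 - a}")
      case True
      then have "a * a \<le> t * (1 - t)" using a by (intro mult_mono) auto
      then show ?thesis using M[of t] a unfolding abs_divide by (intro frac_le) auto
    next
      case False
      have "0 \<le> M" using M[of 0] by linarith
      then show ?thesis using a(3)[OF False] a(1) by simp
    qed
  qed measurable
  then show rhs: "set_integrable lborel ?I (\<lambda>t. 1 / (t * (1 - t)) * U \<beta> t * \<phi> t)"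
    by (simp add: mult_ac)
  have E: "?E (t, y) = U \<beta> t * \<phi> t * (1 / (t - y)\<^sup>2)" if "y \<in> - ?I" for t y
    using that a(3)[of y] a(1) by (auto simp: gagliardo_integrand_def U_def)
  have meas: "?E \<in> borel_measurable borel" by (rule gagliardo_integrand_measurable) fact
  have inner: "set_integrable lborel (- ?I) (\<lambda>y. ?E (t, y))"
    "(LINT y:- ?I|lborel. ?E (t, y)) = 1 / (t * (1 - t)) * U \<beta> t * \<phi> t" if "t \<in> ?I" for t
  proof -
    show "set_integrable lborel (- ?I) (\<lambda>y. ?E (t, y))"
      by (rule set_integrable_congI[OF E]) (auto intro: integral_inverse_square_outside(1)[OF that] simp del: times_divide_eq_right)
    have "(LINT y:- ?I|lborel. ?E (t, y)) = (LINT y:- ?I|lborel. U \<beta> t * \<phi> t * (1 / (t - y)\<^sup>2))"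
      by (rule set_lebesgue_integral_cong) (auto simp: E)
    also have "\<dots> = U \<beta> t * \<phi> t * (1 / (t * (1 - t)))"
      by (simp only: set_integral_mult_right integral_inverse_square_outside(2)[OF that])
    finally show "(LINT y:- ?I|lborel. ?E (t, y)) = 1 / (t * (1 - t)) * U \<beta> t * \<phi> t" by simp
  qed
  show int: "set_integrable lborel (?I \<times> - ?I) ?E"
  proof (rule set_integrable_plane_Tonelli)
    show "0 \<le> ?E (t, y)" if "y \<in> - ?I" for t y
      using E[OF that] nonneg[of t] U_nonneg[of \<beta> t] by simp
    show "set_integrable lborel ?I (\<lambda>t. LINT y:- ?I|lborel. ?E (t, y))"
      by (rule set_integrable_congI[OF inner(2) rhs])
  qed (use meas inner in auto)
  show "(LINT z:?I \<times> - ?I|lborel. ?E z) = (LINT t:?I|lborel. 1 / (t * (1 - t)) * U \<beta> t * \<phi> t)"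
    unfolding set_integral_plane_Fubini(1)[OF int]
    by (rule set_lebesgue_integral_cong) (auto simp: inner(2))
qed

text \<open>The test function multiplied by minus the slope of the tangent to \<open>x powr \<beta>\<close> at \<open>x = dI t\<close>. Replacing \<open>dI t\<close> by
  \<open>max (dI t) a\<close> changes nothing when \<open>\<phi>\<close> vanishes outside \<open>[a, 1 - a]\<close>, and makes the weight Lipschitz on
  the whole line whenever \<open>\<phi>\<close> is bounded and Lipschitz.\<close>

definition tangent_weight :: "real \<Rightarrow> real \<Rightarrow> (real \<Rightarrow> real) \<Rightarrow> real \<Rightarrow> real" where
  "tangent_weight \<beta> a \<phi> t = - \<beta> * max (dI t) a powr (\<beta> - 1) * \<phi> t"

lemma tangent_weight_eq:
  assumes "\<And>t. t \<notin> {a..1 - a} \<Longrightarrow> \<phi> t = 0"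
  shows "tangent_weight \<beta> a \<phi> t = - \<beta> * dI t powr (\<beta> - 1) * \<phi> t"
proof (cases "t \<in> {a..1 - a}")
  case True
  then have "max (dI t) a = dI t" by (auto simp: dI_def)
  then show ?thesis by (simp add: tangent_weight_def)
qed (use assms in \<open>simp add: tangent_weight_def\<close>)

lemma tangent_weight_lipschitz:
  assumes "\<beta> \<le> 0" "0 < a" and lip: "L-lipschitz_on UNIV \<phi>" and M: "\<And>t. \<bar>\<phi> t\<bar> \<le> M"
  obtains L' where "L'-lipschitz_on UNIV (tangent_weight \<beta> a \<phi>)"
proof
  define g where "g t = max (dI t) a powr (\<beta> - 1)" for t
  define G A where "G = (1 - \<beta>) * a powr (\<beta> - 2)" and "A = a powr (\<beta> - 1)"
  have L: "0 \<le> L" using lip by (rule lipschitz_on_nonneg)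
  have M0: "0 \<le> M" using M[of 0] by linarith
  have G: "0 \<le> G" "0 \<le> A" using assms by (auto simp: G_def A_def)
  have gA: "\<bar>g t\<bar> \<le> A" for t
    unfolding g_def A_def using assms by (simp add: powr_mono2')
  have gG: "\<bar>g t - g y\<bar> \<le> G * \<bar>t - y\<bar>" for t y
  proof -
    have "\<bar>g t - g y\<bar> \<le> - (\<beta> - 1) * a powr (\<beta> - 1 - 1) * \<bar>max (dI t) a - max (dI y) a\<bar>"
      unfolding g_def using assms by (intro powr_lipschitz) auto
    also have "\<dots> \<le> - (\<beta> - 1) * a powr (\<beta> - 1 - 1) * \<bar>t - y\<bar>"
      using dI_lipschitz[of t y] assms by (intro mult_left_mono) (auto simp: max_def)
    finally show ?thesis by (simp add: G_def)
  qed
  have \<phi>: "\<bar>\<phi> t - \<phi> y\<bar> \<le> L * \<bar>t - y\<bar>" for t y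
    using lipschitz_onD[OF lip, of t y] by (simp add: dist_real_def)
  have prod: "\<bar>g t * \<phi> t - g y * \<phi> y\<bar> \<le> (A * L + G * M) * \<bar>t - y\<bar>" for t y
  proof -
    have "g t * \<phi> t - g y * \<phi> y = g t * (\<phi> t - \<phi> y) + (g t - g y) * \<phi> y" by (simp add: algebra_simps)
    then have "\<bar>g t * \<phi> t - g y * \<phi> y\<bar> \<le> \<bar>g t\<bar> * \<bar>\<phi> t - \<phi> y\<bar> + \<bar>g t - g y\<bar> * \<bar>\<phi> y\<bar>"
      by (metis abs_mult abs_triangle_ineq)
    also have "\<dots> \<le> A * (L * \<bar>t - y\<bar>) + (G * \<bar>t - y\<bar>) * M"
      using gA gG \<phi> M G by (intro add_mono mult_mono) auto
    finally show ?thesis by (simp add: algebra_simps)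
  qed
  show "(- \<beta> * (A * L + G * M))-lipschitz_on UNIV (tangent_weight \<beta> a \<phi>)"
  proof (rule lipschitz_onI)
    fix t y :: real
    have "tangent_weight \<beta> a \<phi> t - tangent_weight \<beta> a \<phi> y = - \<beta> * (g t * \<phi> t - g y * \<phi> y)"
      by (simp add: tangent_weight_def g_def algebra_simps)
    then have "\<bar>tangent_weight \<beta> a \<phi> t - tangent_weight \<beta> a \<phi> y\<bar> = - \<beta> * \<bar>g t * \<phi> t - g y * \<phi> y\<bar>"
      using assms(1) by (simp add: abs_mult)
    also have "\<dots> \<le> - \<beta> * ((A * L + G * M) * \<bar>t - y\<bar>)"
      using prod assms(1) by (intro mult_left_mono) auto
    finally show "dist (tangent_weight \<beta> a \<phi> t) (tangent_weight \<beta> a \<phi> y) \<le> - \<beta> * (A * L + G * M) * dist t y"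
      by (simp add: dist_real_def)
    show "0 \<le> - \<beta> * (A * L + G * M)"
      using assms(1) G L M0 by (intro mult_nonneg_nonneg add_nonneg_nonneg) auto
  qed
qed

text \<open>The tangent inequality at \<open>dI t\<close>, multiplied by \<open>\<phi> t \<ge> 0\<close>, and the one at \<open>dI y\<close>, multiplied by \<open>\<phi> y \<ge> 0\<close>,
  add up to an inequality between the two symmetric integrands. No integral has to be split, so convexity
  is used before any limit is taken.\<close>

lemma gagliardo_le_tent_form:
  assumes "\<beta> \<le> 0" and nonneg: "\<And>t. 0 \<le> \<phi> t"
    and w: "\<And>t. w t = - \<beta> * dI t powr (\<beta> - 1) * \<phi> t"
    and "t \<in> {0<..<1}" "y \<in> {0<..<1}"
  shows "gagliardo_integrand (U \<beta>) \<phi> (t, y) \<le> - ((w t - w y) * tent_kernel (t, y))"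
proof -
  have half: "\<phi> t * (U \<beta> t - U \<beta> y) \<le> - w t * (dI t - dI y)" if "t \<in> {0<..<1}" "y \<in> {0<..<1}" for t y
  proof -
    have "U \<beta> t - U \<beta> y \<le> \<beta> * dI t powr (\<beta> - 1) * (dI t - dI y)"
      using powr_above_tangent[of "dI t" "dI y" \<beta>] that assms(1) by (simp add: U_def dI_def)
    then have "\<phi> t * (U \<beta> t - U \<beta> y) \<le> \<phi> t * (\<beta> * dI t powr (\<beta> - 1) * (dI t - dI y))"
      using nonneg by (rule mult_left_mono)
    then show ?thesis by (simp add: w mult_ac)
  qed
  have "(U \<beta> t - U \<beta> y) * (\<phi> t - \<phi> y) = \<phi> t * (U \<beta> t - U \<beta> y) + \<phi> y * (U \<beta> y - U \<beta> t)"
    by (simp add: algebra_simps)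
  also have "\<dots> \<le> - w t * (dI t - dI y) + - w y * (dI y - dI t)"
    using half[of t y] half[of y t] assms by (intro add_mono) auto
  also have "\<dots> = - ((w t - w y) * (dI t - dI y))" by (simp add: algebra_simps)
  finally have "(U \<beta> t - U \<beta> y) * (\<phi> t - \<phi> y) / (t - y)\<^sup>2 \<le> - ((w t - w y) * (dI t - dI y)) / (t - y)\<^sup>2"
    by (rule divide_right_mono) simp
  then show ?thesis by (simp add: gagliardo_integrand_def tent_kernel_def)
qed

text \<open>The pairs in the square of the interval contribute at most \<open>\<integral> \<beta> * H * U * \<phi>\<close> by the tangent inequality and the identity for \<open>dI\<close>,
  because the weight \<open>w\<close> satisfies \<open>w * (dI * H) = - \<beta> * H * U * \<phi>\<close>. Each of the two
  products of the interval with its complement contributes \<open>\<integral> U * \<phi> / (t * (1 - t))\<close>, and pairs of points outside the interval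
  contribute nothing.\<close>

proposition half_laplacian_U_le:
  assumes \<beta>: "-1 < \<beta>" "\<beta> < 0"
  shows "half_laplacian_le_weakly {0<..<1} (U \<beta>)
           (\<lambda>t. \<beta> * H t * U \<beta> t + 2 / (t * (1 - t)) * U \<beta> t)"
  unfolding half_laplacian_le_weakly_def
proof (intro ballI impI)
  fix \<phi> assume \<phi>: "\<phi> \<in> test_fun {0<..<1}" and "\<forall>t. 0 \<le> \<phi> t"
  then have nonneg: "\<And>t. 0 \<le> \<phi> t" by blast
  let ?I = "{0<..<1} :: real set" and ?E = "gagliardo_integrand (U \<beta>) \<phi>"
  let ?F = "\<lambda>t. (\<beta> * H t * U \<beta> t + 2 / (t * (1 - t)) * U \<beta> t) * \<phi> t"
  let ?in = "\<lambda>t. \<beta> * H t * U \<beta> t * \<phi> t" and ?out = "\<lambda>t. 1 / (t * (1 - t)) * U \<beta> t * \<phi> t"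
  obtain a L M where a: "0 < a" "a < 1/2" "\<And>t. t \<notin> {a..1 - a} \<Longrightarrow> \<phi> t = 0"
    and lip: "L-lipschitz_on UNIV \<phi>" and M: "0 < M" "\<And>t. \<bar>\<phi> t\<bar> \<le> M"
    by (rule test_fun_unit_interval[OF \<phi>]) (rule that)
  have \<phi>_meas[measurable]: "\<phi> \<in> borel_measurable borel" by (rule continuous_lipschitz_measurable[OF lip])
  have E_meas: "?E \<in> borel_measurable borel" by (rule gagliardo_integrand_measurable) fact
  define w where "w = tangent_weight \<beta> a \<phi>"
  have w: "w t = - \<beta> * dI t powr (\<beta> - 1) * \<phi> t" for t
    unfolding w_def by (rule tangent_weight_eq[OF a(3)])
  obtain L' where w_lip: "L'-lipschitz_on UNIV w"
    unfolding w_def using tangent_weight_lipschitz[OF less_imp_le[OF \<beta>(2)] a(1) lip M(2)] .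
  note tent = tent_form_identity[OF w_lip]
  let ?P = "\<lambda>(t, y). (w t - w y) * tent_kernel (t, y)"
  have wH: "?in t = - (w t * (dI t * H t))" if "t \<in> ?I" for t
  proof -
    have "0 < dI t" using that by (simp add: dI_def)
    then have "dI t powr (\<beta> - 1) * dI t = dI t powr \<beta>" by (simp add: powr_diff)
    then show ?thesis using that by (simp add: w U_def mult_ac)
  qed
  have in_int: "set_integrable lborel ?I ?in"
    by (rule set_integrable_congI[OF wH]) (use tent(3) in \<open>simp_all add: set_integrable_def\<close>)
  have outer: "set_integrable lborel ?I ?out" "set_integrable lborel (?I \<times> - ?I) ?E"
      "(LINT z:?I \<times> - ?I|lborel. ?E z) = (LINT t:?I|lborel. ?out t)"
    by (rule gagliardo_outside[where a = a and M = M]; fact)+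
  have square: "set_integrable lborel (?I \<times> ?I) ?E"
    by (rule gagliardo_integrable_square[where a = a and M = M]) fact+
  have inner: "(LINT z:?I \<times> ?I|lborel. ?E z) \<le> (LINT t:?I|lborel. ?in t)"
  proof -
    have P: "set_integrable lborel (?I \<times> ?I) (\<lambda>z. - ?P z)"
      using tent(1) by (simp add: set_integrable_def)
    have "(LINT z:?I \<times> ?I|lborel. ?E z) \<le> (LINT z:?I \<times> ?I|lborel. - ?P z)"
      using gagliardo_le_tent_form[OF less_imp_le[OF \<beta>(2)] nonneg w]
      by (intro set_integral_mono[OF square P]) auto
    also have "\<dots> = - (LINT t:?I|lborel. w t * (dI t * H t))"
      using set_integral_uminus[OF tent(1)] tent(2) by simp
    also have "\<dots> = (LINT t:?I|lborel. - (w t * (dI t * H t)))"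
      using set_integral_uminus[OF tent(3)] by simp
    also have "\<dots> = (LINT t:?I|lborel. ?in t)"
      by (rule set_lebesgue_integral_cong) (auto simp: wH)
    finally show ?thesis .
  qed
  have sym': "(\<lambda>(y, t). ?E (t, y)) = ?E" by (auto simp: fun_eq_iff gagliardo_integrand_sym)
  note outer' = set_integral_plane_swap[OF outer(2), unfolded sym']
  have split: "?E z = indicator (?I \<times> ?I) z *\<^sub>R ?E z + indicator (?I \<times> - ?I) z *\<^sub>R ?E z
      + indicator ((- ?I) \<times> ?I) z *\<^sub>R ?E z" for z
  proof -
    obtain t y where z: "z = (t, y)" by (cases z)
    have "?E z = 0" if "t \<notin> ?I" "y \<notin> ?I"
    proof -
      have "U \<beta> t = 0" "U \<beta> y = 0" using that by (simp_all only: U_def if_False)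
      then show ?thesis by (simp add: z gagliardo_integrand_def)
    qed
    then show ?thesis by (auto simp: z indicator_def)
  qed
  have parts: "integrable lborel (\<lambda>z. indicator (?I \<times> ?I) z *\<^sub>R ?E z)"
      "integrable lborel (\<lambda>z. indicator (?I \<times> - ?I) z *\<^sub>R ?E z)"
      "integrable lborel (\<lambda>z. indicator ((- ?I) \<times> ?I) z *\<^sub>R ?E z)"
    using square outer(2) outer'(1) by (simp_all only: set_integrable_def)
  note sum_int = Bochner_Integration.integrable_add[OF Bochner_Integration.integrable_add[OF parts(1,2)] parts(3)]
  have E_int: "integrable lborel ?E"
    using sum_int by (simp only: split[symmetric])
  have "(\<integral>z. ?E z \<partial>lborel) = (\<integral>z. indicator (?I \<times> ?I) z *\<^sub>R ?E z + indicator (?I \<times> - ?I) z *\<^sub>R ?E z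
      + indicator ((- ?I) \<times> ?I) z *\<^sub>R ?E z \<partial>lborel)"
    by (simp only: split[symmetric])
  also have "\<dots> = (LINT z:?I \<times> ?I|lborel. ?E z) + (LINT z:?I \<times> - ?I|lborel. ?E z)
      + (LINT z:(- ?I) \<times> ?I|lborel. ?E z)"
    unfolding set_lebesgue_integral_def
    by (simp only: Bochner_Integration.integral_add Bochner_Integration.integrable_add parts)
  also have "\<dots> = (LINT z:?I \<times> ?I|lborel. ?E z) + 2 * (LINT t:?I|lborel. ?out t)"
    using outer(3) outer'(2) by simp
  also have "\<dots> \<le> (LINT t:?I|lborel. ?in t) + (LINT t:?I|lborel. 2 * ?out t)"
    using inner by (simp only: set_integral_mult_right add_le_cancel_right)
  finally have E_le: "(\<integral>z. ?E z \<partial>lborel) \<le> (LINT t:?I|lborel. ?in t) + (LINT t:?I|lborel. 2 * ?out t)" .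
  have out2: "set_integrable lborel ?I (\<lambda>t. 2 * ?out t)" by (rule set_integrable_mult_right) (rule outer(1))
  have F: "?F = (\<lambda>t. ?in t + 2 * ?out t)" by (auto simp: fun_eq_iff algebra_simps)
  have F_int: "set_integrable lborel ?I ?F" unfolding F by (rule set_integral_add(1)[OF in_int out2])
  have F_eq: "(LINT t:?I|lborel. ?F t) = (LINT t:?I|lborel. ?in t) + (LINT t:?I|lborel. 2 * ?out t)"
    unfolding F by (rule set_integral_add(2)[OF in_int out2])
  have F_meas: "(\<lambda>t. indicator ?I t *\<^sub>R ?F t) \<in> borel_measurable lborel"
    using F_int unfolding set_integrable_def by (rule borel_measurable_integrable)
  have E_meas': "?E \<in> borel_measurable lborel" using E_meas by simp
  show "integrable lebesgue ?E \<and> set_integrable lebesgue ?I ?F \<and> gagliardo_form (U \<beta>) \<phi> \<le> (LINT t:?I|lebesgue. ?F t)"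
    using E_int E_le F_int F_eq
    unfolding gagliardo_form_def set_integrable_def set_lebesgue_integral_def
      integrable_completion[OF E_meas'] integral_completion[OF E_meas']
      integrable_completion[OF F_meas] integral_completion[OF F_meas]
    by simp
qed

section \<open>Failure of superharmonicity\<close>

lemma set_integral_negative:
  fixes f :: "real \<Rightarrow> real"
  assumes f: "set_integrable lebesgue A f" and B: "B \<subseteq> A" "B \<in> sets lebesgue" "emeasure lebesgue B \<noteq> 0"
    and neg: "AE t in lebesgue. t \<in> B \<longrightarrow> f t < 0" and zero: "\<And>t. t \<notin> B \<Longrightarrow> f t = 0"
  shows "(LINT t:A|lebesgue. f t) < 0"
proof -
  let ?g = "\<lambda>t. - (indicator A t *\<^sub>R f t)"
  have g: "integrable lebesgue ?g" using f by (simp only: set_integrable_def Bochner_Integration.integrable_minus)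
  have g_nonneg: "AE t in lebesgue. 0 \<le> ?g t"
    using neg
  proof eventually_elim
    case (elim t)
    then show ?case using zero[of t] by (cases "t \<in> B") (auto simp: indicator_def)
  qed
  have "integral\<^sup>L lebesgue ?g \<noteq> 0"
  proof
    assume "integral\<^sup>L lebesgue ?g = 0"
    then have "AE t in lebesgue. ?g t = 0" using integral_nonneg_eq_0_iff_AE[OF g g_nonneg] by blast
    then have "AE t in lebesgue. t \<notin> B"
      using neg
    proof eventually_elim
      case (elim t)
      then show ?case using B(1) by (auto simp: indicator_def)
    qed
    then have "emeasure lebesgue B = 0" using AE_iff_null_sets[OF B(2)] by auto
    with B(3) show False ..
  qed
  moreover have "0 \<le> integral\<^sup>L lebesgue ?g" using g_nonneg by (rule integral_nonneg_AE)
  ultimately show ?thesis by (simp add: set_lebesgue_integral_def)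
qed

text \<open>Near \<open>1/2\<close> the right-hand side of the weak inequality is negative, so a bump function supported there makes the form
  negative.\<close>

proposition U_not_superharmonic:
  assumes \<beta>: "-1 < \<beta>" "\<beta> < 0"
  shows "\<not> loc_weakly_half_superharmonic {0<..<1} (U \<beta>)"
proof
  assume sup: "loc_weakly_half_superharmonic {0<..<1} (U \<beta>)"
  let ?f = "\<lambda>t. \<beta> * H t * U \<beta> t + 2 / (t * (1 - t)) * U \<beta> t"
  have "\<forall>\<^sub>F t in at (1/2). ?f t < 0"
    using rhs_at_bot[OF \<beta>(2)] by (simp only: filterlim_at_bot_dense)
  then obtain d where d: "0 < d" "\<And>t. t \<noteq> 1/2 \<Longrightarrow> dist t (1/2) < d \<Longrightarrow> ?f t < 0"
    unfolding eventually_at by blast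
  define r where "r = min d (1/4)"
  define B where "B = {1/2 - r<..<1/2 + r}"
  have r: "0 < r" "r \<le> d" "r \<le> 1/4" using d(1) by (auto simp: r_def)
  then have "{1/2 - r..1/2 + r} \<subseteq> {0<..<1}" by auto
  then obtain \<phi> where \<phi>: "\<phi> \<in> test_fun {0<..<1}" "\<And>t. 0 \<le> \<phi> t" "\<And>t. 0 < \<phi> t \<longleftrightarrow> t \<in> B"
    unfolding B_def using exists_bump_test_fun[OF r(1)] by metis
  have weak: "set_integrable lebesgue {0<..<1} (\<lambda>t. ?f t * \<phi> t)"
      "gagliardo_form (U \<beta>) \<phi> \<le> (LINT t:{0<..<1}|lebesgue. ?f t * \<phi> t)"
    using half_laplacian_U_le[OF \<beta>] \<phi>(1,2) unfolding half_laplacian_le_weakly_def by blast+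
  have "(LINT t:{0<..<1}|lebesgue. ?f t * \<phi> t) < 0"
  proof (rule set_integral_negative[OF weak(1)])
    show "B \<subseteq> {0<..<1}" "B \<in> sets lebesgue" "emeasure lebesgue B \<noteq> 0"
      using r by (auto simp: B_def)
    have neg: "?f t * \<phi> t < 0" if "t \<in> B" "t \<noteq> 1/2" for t
    proof -
      have "dist t (1/2) < d" using that(1) r unfolding B_def dist_real_def by auto
      then have "?f t < 0" using d(2) that(2) by blast
      then show ?thesis using \<phi>(3) that(1) by (intro mult_neg_pos) blast+
    qed
    show "AE t in lebesgue. t \<in> B \<longrightarrow> ?f t * \<phi> t < 0"
      using AE_completion[OF AE_lborel_singleton[of "1/2::real"]] by eventually_elim (use neg in blast)
    show "?f t * \<phi> t = 0" if "t \<notin> B" for t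
    proof -
      have "\<phi> t = 0" using \<phi>(2)[of t] \<phi>(3)[of t] that by linarith
      then show ?thesis by (simp only: mult_zero_right)
    qed
  qed
  moreover have "0 \<le> gagliardo_form (U \<beta>) \<phi>"
    using sup \<phi>(1,2) unfolding loc_weakly_half_superharmonic_def by blast
  ultimately show False using weak(2) by linarith
qed

theorem lemmaA1:
  fixes \<beta> :: real
  assumes "-1 < \<beta>" and "\<beta> < 0"
  shows "half_laplacian_le_weakly {0<..<1} (U \<beta>)
           (\<lambda>t. \<beta> * H t * U \<beta> t + 2 / (t * (1 - t)) * U \<beta> t)
       \<and> continuous_on ({0<..<1} - {1/2}) H
       \<and> (\<forall>t \<in> {0<..<1} - {1/2}. H t = H (1 - t))
       \<and> (\<forall>q::real. 1 \<le> q \<longrightarrow> H \<in> Lq_loc q {0<..<1})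
       \<and> H \<sim>[at (1/2)] (\<lambda>t. - 4 * ln ((1/2 - t)\<^sup>2))
       \<and> filterlim (\<lambda>t. \<beta> * H t * U \<beta> t + 2 / (t * (1 - t)) * U \<beta> t) at_bot (at (1/2))
       \<and> \<not> loc_weakly_half_superharmonic {0<..<1} (U \<beta>)"
  using assms half_laplacian_U_le H_continuous H_symmetric H_Lq_loc H_asymp_equiv rhs_at_bot
    U_not_superharmonic
  by (intro conjI ballI allI impI) metis+

end
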